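(* There exist positive absolute constants $C_1,C_2,C_3$ such that the following holds. Let $N\ge 1$, $d_n\ge 0$, $d_s\ge 1$ be integers (so that $d_*:=d_n+d_s>0$), let $\alpha\in(0,1/2)$, $\overline{\mathbf w}\in\Omega_{d_n}$, $\epsilon_n>0$, and let $\epsilon_s>0$ in the case of problem $(N_2)$, $\epsilon_s=0$ in the case of problem $(N_1)$. Suppose that $\rho>0$ satisfies $$\rho\ge C_1\,d_*^3\ln(2d_* )\,q_N(\alpha)\,N^{-1/2}$$ or the condition (equivalent up to the choice of absolute constant) $$\rho\ge C_2\,d_*^3\ln(2d_* )\sqrt{N^{-1}\ln(N/\alpha)},$$ and that $$N^{d_n+\frac12}\epsilon_n+N^{d_s+\frac12}\epsilon_s\le C_3\,q_N(\alpha).$$ Then the basic test $\widehat\varphi$ with tolerance $\alpha$, as applied to problem $(N_1)$, respectively $(N_2)$, satisfies $\mathrm{Risk}(\widehat\varphi,\rho)\le\alpha$.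
   Context: Signals. $\mathcal S$ is the space of two-sided real sequences $z=\{z_t\}_{t\in\mathbf Z}$; for $z\in\mathcal S$ and integers $p\le q$, $z_p^q=[z_p;z_{p+1};\ldots;z_q]$. $\Delta$ is the shift on $\mathcal S$: $(\Delta z)_t=z_{t-1}$. For an integer $d\ge1$, $\Omega_d$ is the set of unordered collections (multisets) $\mathbf w=\{\omega_1,\ldots,\omega_d\}$ of $d$ reals that are symmetric mod $2\pi$: for every real $a$, the number of $i$ with $\omega_i\equiv a \pmod{2\pi}$ equals the number of $i$ with $\omega_i\equiv -a\pmod{2\pi}$. For $\mathbf w\in\Omega_d$, $p_{\mathbf w}(\zeta)=\prod_{\ell=1}^d(1-\exp\{\imath\omega_\ell\}\zeta)$ (a real polynomial), $\mathcal S[\mathbf w]=\{x\in\mathcal S: p_{\mathbf w}(\Delta)x\equiv 0\}$, $\mathcal S_d=\bigcup_{\mathbf w\in\Omega_d}\mathcal S[\mathbf w]$. For $\epsilon\ge0$, $\mathcal S^{N,\epsilon}[\mathbf w]=\{x\in\mathcal S:\|[p_{\mathbf w}(\Delta)x]_0^{N-1}\|_\infty\le\epsilon\}$ and $\mathcal S^{N,\epsilon}_d=\bigcup_{\mathbf w\in\Omega_d}\mathcal S^{N,\epsilon}[\mathbf w]$. For $d=0$: $\Omega_0=\{\emptyset\}$, $p_\emptyset\equiv1$, so $\mathcal S^{N,\epsilon}[\emptyset]=\{x\in\mathcal S:\|x_0^{N-1}\|_\infty\le\epsilon\}$. Observations. For $x\in\mathcal S$ one observes $y=x_0^{N-1}+\xi\in\mathbf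 R^N$ with $\xi\sim\mathcal N(0,I_N)$; $\mathrm{Prob}_x$ is the corresponding probability. Problem $(N_1)$ (given $\overline{\mathbf w}\in\Omega_{d_n}$): $H_0=\mathcal S^{N,\epsilon_n}[\overline{\mathbf w}]$, and $H_1(\rho)=\{x=u+s:\ u\in\mathcal S^{N,\epsilon_n}[\overline{\mathbf w}],\ s\in\mathcal S_{d_s},\ \min_{z\in\mathcal S^{N,\epsilon_n}[\overline{\mathbf w}]}\|[x-z]_0^{N-1}\|_\infty\ge\rho\}$. Problem $(N_2)$ (given $\overline{\mathbf w}\in\Omega_{d_n}$): the same, except that in $H_1(\rho)$ the condition $s\in\mathcal S_{d_s}$ is replaced by $s\in\mathcal S^{N,\epsilon_s}_{d_s}$. Tests and risk. A test is a Borel function $\varphi:\mathbf R^N\to\{0,1\}$; $\varphi(y)=1$ means rejecting $H_0$, $\varphi(y)=0$ means rejecting $H_1(\rho)$. $\varepsilon_0(\varphi;H_0)=\sup_{x\in H_0}\mathrm{Prob}_x\{\varphi(y)=1\}$, $\varepsilon_1(\varphi;H_1(\rho))=\sup_{x\in H_1(\rho)}\mathrm{Prob}_x\{\varphi(y)=0\}$, $\mathrm{Risk}(\varphi,\rho)=\max\{\varepsilon_0(\varphi;H_0),\varepsilon_1(\varphi;H_1(\rho))\}$. Fourier transform. $\Gamma_N$ is the set of complex $N$-th roots of unity, and $[F_Nf](\mu)=N^{-1/2}\sum_{t=0}^{N-1}f_t\mu^t$ for $\mu\in\Gamma_N$, $f\in\mathbf C^N$; $\|F_Nf\|_\infty=\max_{\mu\in\Gamma_N}|[F_Nf](\mu)|$.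 $q_N(\alpha)$ is the $(1-\alpha)$-quantile of $\|F_N\xi\|_\infty$, $\xi\sim\mathcal N(0,I_N)$, so that $\mathrm{Prob}\{\|F_N\xi\|_\infty\ge q_N(\alpha)\}\le\alpha$. Basic test $\widehat\varphi$ (tolerance $\alpha$). Given $y$, compute $\mathrm{Opt}_{\mathcal Z}(y)=\min_{z\in\mathcal Z}\|F_N(y-z_0^{N-1})\|_\infty$ with $\mathcal Z=\mathcal S^{N,\epsilon_n}[\overline{\mathbf w}]$. If $\mathrm{Opt}_{\mathcal Z}(y)\le q_N(\alpha)$, accept $H_0$ ($\widehat\varphi(y)=0$); otherwise accept $H_1$ ($\widehat\varphi(y)=1$). *)

theory Defs
  imports "HOL-Probability.Probability" "HOL-Library.Real_Mod"
begin

type_synonym signal = "int \<Rightarrow> real"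

definition shift :: "signal \<Rightarrow> signal" where
  "shift z = (\<lambda>t. z (t - 1))"

definition freqs :: "nat \<Rightarrow> real multiset set" where
  "freqs d = {w. size w = d \<and>
     (\<forall>a. size {#\<omega> \<in># w. [\<omega> = a] (rmod (2 * pi))#} = size {#\<omega> \<in># w. [\<omega> = - a] (rmod (2 * pi))#})}"

definition char_poly :: "real multiset \<Rightarrow> complex poly" where
  "char_poly w = (\<Prod>\<omega>\<in>#w. [:1, - cis \<omega>:])"

text \<open>For symmetric \<open>w\<close> the polynomial is real, hence so are the values of \<open>apply_shift (char_poly w) x\<close>,
  although they are typed as complex numbers.\<close>

definition apply_shift :: "complex poly \<Rightarrow> signal \<Rightarrow> int \<Rightarrow> complex" where
  "apply_shift p x = (\<lambda>t. \<Sum>i\<le>degree p. coeff p i * complex_of_real ((shift ^^ i) x t))"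

text \<open>Uniform norm of the block \<open>f\<^sub>0, \<dots>, f\<^bsub>N-1\<^esub>\<close>; meaningful for \<open>N \<ge> 1\<close>.\<close>

definition block_norm :: "nat \<Rightarrow> (int \<Rightarrow> 'a::real_normed_vector) \<Rightarrow> real" where
  "block_norm N f = Max ((\<lambda>t. norm (f (int t))) ` {..<N})"

definition sig_exact :: "real multiset \<Rightarrow> signal set" where
  "sig_exact w = {x. \<forall>t. apply_shift (char_poly w) x t = 0}"

definition sig_exact_all :: "nat \<Rightarrow> signal set" where
  "sig_exact_all d = (\<Union>w\<in>freqs d. sig_exact w)"

definition sig_approx :: "nat \<Rightarrow> real \<Rightarrow> real multiset \<Rightarrow> signal set" where
  "sig_approx N \<epsilon> w = {x. block_norm N (apply_shift (char_poly w) x) \<le> \<epsilon>}"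

definition sig_approx_all :: "nat \<Rightarrow> real \<Rightarrow> nat \<Rightarrow> signal set" where
  "sig_approx_all N \<epsilon> d = (\<Union>w\<in>freqs d. sig_approx N \<epsilon> w)"

text \<open>A vector of \<open>\<real>\<^sup>N\<close> is an extensional function on \<open>{..<N}\<close>, so that \<open>\<real>\<^sup>N\<close> with its Borel
  \<open>\<sigma>\<close>-algebra is the following product space.\<close>

definition vec_space :: "nat \<Rightarrow> (nat \<Rightarrow> real) measure" where
  "vec_space N = Pi\<^sub>M {..<N} (\<lambda>_. borel)"

definition std_gauss :: "nat \<Rightarrow> (nat \<Rightarrow> real) measure" where
  "std_gauss N = Pi\<^sub>M {..<N} (\<lambda>_. density lborel (\<lambda>u. ennreal (std_normal_density u)))"

definition obs_law :: "nat \<Rightarrow> signal \<Rightarrow> (nat \<Rightarrow> real) measure" where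
  "obs_law N x = distr (std_gauss N) (vec_space N) (\<lambda>\<xi>. \<lambda>t\<in>{..<N}. x (int t) + \<xi> t)"

definition unity_roots :: "nat \<Rightarrow> complex set" where
  "unity_roots N = {\<mu>. \<mu> ^ N = 1}"

definition DFT :: "nat \<Rightarrow> (nat \<Rightarrow> complex) \<Rightarrow> complex \<Rightarrow> complex" where
  "DFT N f \<mu> = complex_of_real (1 / sqrt (real N)) * (\<Sum>t<N. f t * \<mu> ^ t)"

definition DFT_norm :: "nat \<Rightarrow> (nat \<Rightarrow> complex) \<Rightarrow> real" where
  "DFT_norm N f = Max ((\<lambda>\<mu>. norm (DFT N f \<mu>)) ` unity_roots N)"

definition qN :: "nat \<Rightarrow> real \<Rightarrow> real" where
  "qN N \<alpha> = Inf {q. measure (std_gauss N)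
       {\<xi> \<in> space (std_gauss N). DFT_norm N (\<lambda>t. complex_of_real (\<xi> t)) \<le> q} \<ge> 1 - \<alpha>}"

definition Opt :: "nat \<Rightarrow> signal set \<Rightarrow> (nat \<Rightarrow> real) \<Rightarrow> real" where
  "Opt N Z y = (INF z\<in>Z. DFT_norm N (\<lambda>t. complex_of_real (y t - z (int t))))"

definition tests :: "nat \<Rightarrow> ((nat \<Rightarrow> real) \<Rightarrow> nat) set" where
  "tests N = measurable (vec_space N) (count_space {0, 1})"

definition basic_test :: "nat \<Rightarrow> signal set \<Rightarrow> real \<Rightarrow> (nat \<Rightarrow> real) \<Rightarrow> nat" where
  "basic_test N Z \<alpha> = (\<lambda>y. if Opt N Z y \<le> qN N \<alpha> then 0 else 1)"

definition alternative :: "nat \<Rightarrow> signal set \<Rightarrow> signal set \<Rightarrow> real \<Rightarrow> signal set" where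
  "alternative N Z S \<rho> = {x. (\<exists>u\<in>Z. \<exists>s\<in>S. x = (\<lambda>t. u t + s t)) \<and>
     (INF z\<in>Z. block_norm N (\<lambda>t. x t - z t)) \<ge> \<rho>}"

definition H1_N1 :: "nat \<Rightarrow> real multiset \<Rightarrow> real \<Rightarrow> nat \<Rightarrow> real \<Rightarrow> signal set" where
  "H1_N1 N w \<epsilon>n ds \<rho> = alternative N (sig_approx N \<epsilon>n w) (sig_exact_all ds) \<rho>"

definition H1_N2 :: "nat \<Rightarrow> real multiset \<Rightarrow> real \<Rightarrow> nat \<Rightarrow> real \<Rightarrow> real \<Rightarrow> signal set" where
  "H1_N2 N w \<epsilon>n ds \<epsilon>s \<rho> = alternative N (sig_approx N \<epsilon>n w) (sig_approx_all N \<epsilon>s ds) \<rho>"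

text \<open>The risk takes values in \<^typ>\<open>ennreal\<close>, where a supremum over an empty hypothesis is \<open>0\<close>
  (the alternative can be empty).\<close>

definition risk :: "nat \<Rightarrow> signal set \<Rightarrow> signal set \<Rightarrow> ((nat \<Rightarrow> real) \<Rightarrow> nat) \<Rightarrow> ennreal" where
  "risk N H0 H1 \<phi> = max
     (SUP x\<in>H0. emeasure (obs_law N x) {y \<in> space (obs_law N x). \<phi> y = 1})
     (SUP x\<in>H1. emeasure (obs_law N x) {y \<in> space (obs_law N x). \<phi> y = 0})"

end

theory Submission
  imports Defs
begin

text \<open>
  Put \<open>d = dn + ds\<close> and let \<open>Q\<close> be the quantile. With probability at least \<open>1 - \<alpha>\<close> the noise has Fourier
  norm at most \<open>Q\<close>. On that event a signal of the null hypothesis is accepted, because it is itself a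
  candidate in the minimisation. If a signal \<open>x = u + s\<close> of the alternative were accepted, some candidate
  \<open>z\<close> would satisfy \<open>DFT_norm N (x - z) \<le> 3 * Q\<close>. The theorem therefore rests on one deterministic estimate:
  for \<open>x - z = (u - z) + s\<close>, which is nearly annihilated by the product of two root polynomials, the uniform
  norm is at most a constant times \<open>d ^ 3 / sqrt N\<close> times the Fourier norm, up to the defects
  (\<open>approximate_sum_bound\<close>). Hence \<open>x\<close> would be closer than \<open>\<rho>\<close> to the null hypothesis.

  The estimate comes from short reproducing filters (\<open>exists_reproducing_filter\<close>). Let \<open>p\<close> be the polynomial
  \<open>\<Prod>(1 - \<zeta> z)\<close> with \<open>d\<close> unimodular \<open>\<zeta>\<close>. For \<open>M\<close> at least of order \<open>d ^ 3\<close> there is a polynomial \<open>q\<close> of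
  degree at most \<open>M\<close> without constant term such that \<open>p\<close> divides \<open>1 - q\<close> and the coefficients of \<open>q\<close> have
  squared Euclidean norm of order \<open>d ^ 3 / M\<close>. A signal annihilated by \<open>p\<close> is reproduced by \<open>q\<close>, hence by
  \<open>q\<^sup>2\<close>. In the Fourier domain, applying \<open>q\<^sup>2\<close> means multiplying by the values of \<open>q\<^sup>2\<close>, whose \<open>\<ell>\<^sub>1\<close> norm is
  the squared \<open>\<ell>\<^sub>2\<close> norm of the values of \<open>q\<close>, so Parseval's identity gives the bound on the half of the
  observation window that lies to the right; reversing time covers the other half.

  To construct \<open>q\<close>, start from the Blaschke-like quotients \<open>(1 - \<zeta> z) / (1 - \<zeta> z / R\<^sup>2)\<close>, each of which has
  constant modulus \<open>R\<close> on the circle of radius \<open>R\<close>. Truncating the denominators' geometric series far out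
  turns their product into a polynomial multiple \<open>r\<close> of \<open>p\<close> with constant term \<open>1\<close> and norm almost \<open>R ^ d\<close>,
  weighted by powers of \<open>R\<close>; so for \<open>R\<close> close to \<open>1\<close> all other coefficients are small. The high powers in
  \<open>r\<close> are then replaced by low-degree representatives modulo \<open>p\<close> (\<open>exists_power_reduction\<close>). Their norms
  grow exponentially, but more slowly than the coefficients of \<open>r\<close> decay.

  The remaining ingredients are elementary: an approximate solution of a recurrence of order \<open>k\<close> differs
  from an exact one by at most \<open>N ^ k\<close> times the defect (\<open>approximate_signal_correction\<close>), the quantile is
  attained, and a Chernoff bound shows that it is \<open>O(sqrt (ln (N / \<alpha>)))\<close>, which makes the two conditions on
  \<open>\<rho>\<close> comparable.
\<close>

section \<open>Weighted coefficient norms\<close>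

text \<open>By Parseval, this is the root mean square of \<open>P\<close> over the circle of radius \<open>R\<close>.\<close>

definition wnorm :: "real \<Rightarrow> complex poly \<Rightarrow> real" where
  "wnorm R P = L2_set (\<lambda>i. R ^ i * cmod (coeff P i)) {..degree P}"

definition onenorm :: "complex poly \<Rightarrow> real" where
  "onenorm P = (\<Sum>i\<le>degree P. cmod (coeff P i))"

definition root_poly :: "complex multiset \<Rightarrow> complex poly" where
  "root_poly \<Lambda> = (\<Prod>\<zeta>\<in>#\<Lambda>. [:1, - \<zeta>:])"

text \<open>A common summation range makes polynomials of different degrees comparable.\<close>

lemma wnorm_eq:
  assumes "degree P \<le> n"
  shows "wnorm R P = L2_set (\<lambda>i. R ^ i * cmod (coeff P i)) {..n}"
  unfolding wnorm_def L2_set_def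
  by (rule arg_cong[where f = sqrt], rule sum.mono_neutral_left) (use assms in \<open>auto simp: coeff_eq_0\<close>)

lemma onenorm_eq:
  assumes "degree P \<le> n"
  shows "onenorm P = (\<Sum>i\<le>n. cmod (coeff P i))"
  unfolding onenorm_def
  by (rule sum.mono_neutral_left) (use assms in \<open>auto simp: coeff_eq_0\<close>)

lemma wnorm_nonneg: "wnorm R P \<ge> 0"
  by (simp add: wnorm_def)

lemma wnorm_0 [simp]: "wnorm R 0 = 0"
  by (simp add: wnorm_def)

lemma wnorm_1 [simp]: "wnorm R 1 = 1"
  by (simp add: wnorm_def)

lemma onenorm_nonneg: "onenorm P \<ge> 0"
  by (simp add: onenorm_def sum_nonneg)

lemma onenorm_0 [simp]: "onenorm 0 = 0"
  by (simp add: onenorm_def)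

lemma wnorm_add:
  assumes "R \<ge> 0"
  shows "wnorm R (P + Q) \<le> wnorm R P + wnorm R Q"
proof -
  define n where "n = max (degree P) (degree Q)"
  have n: "degree P \<le> n" "degree Q \<le> n" "degree (P + Q) \<le> n"
    by (auto simp: n_def degree_add_le_max)
  have "wnorm R (P + Q) \<le> L2_set (\<lambda>i. R ^ i * cmod (coeff P i) + R ^ i * cmod (coeff Q i)) {..n}"
    unfolding wnorm_eq[OF n(3)] using assms
    by (intro L2_set_mono) (auto simp: distrib_left[symmetric] norm_triangle_ineq intro!: mult_left_mono)
  also have "\<dots> \<le> wnorm R P + wnorm R Q"
    unfolding wnorm_eq[OF n(1)] wnorm_eq[OF n(2)] by (rule L2_set_triangle_ineq)
  finally show ?thesis .
qed

lemma onenorm_add: "onenorm (P + Q) \<le> onenorm P + onenorm Q"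
proof -
  define n where "n = max (degree P) (degree Q)"
  have n: "degree P \<le> n" "degree Q \<le> n" "degree (P + Q) \<le> n"
    by (auto simp: n_def degree_add_le_max)
  show ?thesis
    unfolding onenorm_eq[OF n(1)] onenorm_eq[OF n(2)] onenorm_eq[OF n(3)] sum.distrib[symmetric]
    by (intro sum_mono) (auto simp: norm_triangle_ineq)
qed

lemma wnorm_smult: "R \<ge> 0 \<Longrightarrow> wnorm R (smult c P) = cmod c * wnorm R P"
  unfolding wnorm_eq[OF degree_smult_le]
  unfolding wnorm_def L2_set_def
  by (simp add: norm_mult power_mult_distrib real_sqrt_mult mult.assoc mult.left_commute[of _ "cmod c ^ 2"]
      flip: sum_distrib_left) 

lemma onenorm_smult: "onenorm (smult c P) = cmod c * onenorm P"
  unfolding onenorm_eq[OF degree_smult_le]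
  by (simp add: onenorm_def norm_mult sum_distrib_left)

lemma wnorm_minus: "R \<ge> 0 \<Longrightarrow> wnorm R (- P) = wnorm R P"
  using wnorm_smult[of R "-1" P] by simp

lemma onenorm_minus: "onenorm (- P) = onenorm P"
  using onenorm_smult[of "-1" P] by simp

lemma wnorm_sum:
  assumes "R \<ge> 0"
  shows "wnorm R (\<Sum>i\<in>A. f i) \<le> (\<Sum>i\<in>A. wnorm R (f i))"
proof (induction A rule: infinite_finite_induct)
  case (insert x F)
  then show ?case using wnorm_add[OF assms, of "f x" "sum f F"] by simp
qed auto

lemma onenorm_sum: "onenorm (\<Sum>i\<in>A. f i) \<le> (\<Sum>i\<in>A. onenorm (f i))"
proof (induction A rule: infinite_finite_induct)
  case (insert x F)
  then show ?case using onenorm_add[of "f x" "sum f F"] by simp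
qed auto

lemma degree_monom_times_le: "degree (monom c k * P) \<le> k + degree P"
  by (metis add_le_mono1 degree_monom_le degree_mult_le order_trans)

lemma wnorm_monom_mult:
  assumes "R \<ge> 0"
  shows "wnorm R (monom c k * P) = cmod c * R ^ k * wnorm R P"
proof -
  let ?g = "\<lambda>i. (R ^ i * cmod (coeff (monom c k * P) i))\<^sup>2"
  have "(\<Sum>i\<le>k + degree P. ?g i) = (\<Sum>i\<in>{k..k + degree P}. ?g i)"
    by (rule sum.mono_neutral_right) (auto simp: coeff_monom_mult)
  also have "\<dots> = (\<Sum>i\<le>degree P. ?g (k + i))"
    by (rule sum.reindex_bij_witness[of _ "\<lambda>i. k + i" "\<lambda>i. i - k"]) auto
  also have "\<dots> = (\<Sum>i\<le>degree P. (cmod c * R ^ k)\<^sup>2 * (R ^ i * cmod (coeff P i))\<^sup>2)"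
    by (intro sum.cong) (auto simp: coeff_monom_mult norm_mult power_add power_mult_distrib)
  finally show ?thesis
    unfolding wnorm_eq[OF degree_monom_times_le] unfolding wnorm_def L2_set_def
    using assms by (simp add: sum_distrib_left[symmetric] real_sqrt_mult abs_mult)
qed

lemma onenorm_monom_mult: "onenorm (monom c k * P) = cmod c * onenorm P"
proof -
  let ?g = "\<lambda>i. cmod (coeff (monom c k * P) i)"
  have "(\<Sum>i\<le>k + degree P. ?g i) = (\<Sum>i\<in>{k..k + degree P}. ?g i)"
    by (rule sum.mono_neutral_right) (auto simp: coeff_monom_mult)
  also have "\<dots> = (\<Sum>i\<le>degree P. ?g (k + i))"
    by (rule sum.reindex_bij_witness[of _ "\<lambda>i. k + i" "\<lambda>i. i - k"]) auto
  finally show ?thesis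
    unfolding onenorm_eq[OF degree_monom_times_le] onenorm_def[of P]
    by (simp add: coeff_monom_mult norm_mult sum_distrib_left)
qed

lemma mult_as_sum_monom: "P * Q = (\<Sum>i\<le>degree P. monom (coeff P i) i * Q)"
  by (subst poly_as_sum_of_monoms[of P, symmetric]) (simp add: sum_distrib_right)

text \<open>Young's convolution inequality for coefficient sequences.\<close>

lemma wnorm_mult: "wnorm 1 (P * Q) \<le> onenorm P * wnorm 1 Q"
proof -
  have "wnorm 1 (P * Q) \<le> (\<Sum>i\<le>degree P. wnorm 1 (monom (coeff P i) i * Q))"
    unfolding mult_as_sum_monom[of P Q] by (rule wnorm_sum) simp
  also have "\<dots> = onenorm P * wnorm 1 Q"
    by (simp add: wnorm_monom_mult onenorm_def sum_distrib_right)
  finally show ?thesis .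
qed

lemma onenorm_mult: "onenorm (P * Q) \<le> onenorm P * onenorm Q"
proof -
  have "onenorm (P * Q) \<le> (\<Sum>i\<le>degree P. onenorm (monom (coeff P i) i * Q))"
    unfolding mult_as_sum_monom[of P Q] by (rule onenorm_sum)
  also have "\<dots> = onenorm P * onenorm Q"
    by (simp add: onenorm_monom_mult onenorm_def[of P] sum_distrib_right)
  finally show ?thesis .
qed

section \<open>Multiples of a root polynomial that are close to one\<close>

lemma coeff_linear_mult:
  "coeff ([:1, - \<zeta>:] * u) i = coeff u i - \<zeta> * (case i of 0 \<Rightarrow> 0 | Suc j \<Rightarrow> coeff u j)" for \<zeta> :: complex
  by (auto split: nat.split)

text \<open>The identity behind the modulus of a Blaschke factor: the mixed terms \<open>Re (cnj a * \<zeta> * b)\<close> enter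
  with the same coefficient and cancel, and what is left telescopes along a coefficient sequence.\<close>

lemma cmod_blaschke_identity:
  fixes a b \<zeta> :: complex
  assumes "R > 0" "cmod \<zeta> = 1"
  shows "R\<^sup>2 * (cmod (a - \<zeta> / of_real (R\<^sup>2) * b))\<^sup>2 - (cmod (a - \<zeta> * b))\<^sup>2
     = (R\<^sup>2 - 1) * ((cmod a)\<^sup>2 - (cmod b)\<^sup>2 / R\<^sup>2)"
proof -
  have l: "(Re \<zeta>)\<^sup>2 + (Im \<zeta>)\<^sup>2 = 1" using assms(2) by (metis cmod_power2 power_one)
  define S where "S = R\<^sup>2"
  have S: "S > 0" using assms by (simp add: S_def)
  have e: "cmod (a - x * b) ^ 2 = (cmod a)\<^sup>2 + (cmod x)\<^sup>2 * (cmod b)\<^sup>2 - 2 * Re (cnj a * x * b)" for x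
    by (simp only: cmod_power2) (simp add: power2_eq_square algebra_simps)
  have m1: "cmod (\<zeta> / of_real S) = 1 / S" using assms S by (simp add: norm_divide)
  have m2: "Re (cnj a * (\<zeta> / of_real S) * b) = Re (cnj a * \<zeta> * b) / S"
    by (metis (no_types, lifting) Re_divide_of_real times_divide_eq_left times_divide_eq_right)
  show ?thesis
    unfolding S_def[symmetric] e m1 m2 assms(2) using S
    by (simp add: field_simps power2_eq_square)
qed

text \<open>On the circle of radius \<open>R\<close> one has \<open>\<bar>1 - \<zeta> z\<bar> = R * \<bar>1 - \<zeta> z / R\<^sup>2\<bar>\<close>, because the
  zeros \<open>1 / \<zeta>\<close> and \<open>R\<^sup>2 / \<zeta>\<close> are mirror images in this circle. For coefficients, this is the sum of the
  preceding identity over all indices.\<close>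

lemma wnorm_blaschke:
  assumes "R > 0" "cmod \<zeta> = 1"
  shows "wnorm R ([:1, - \<zeta>:] * u) = R * wnorm R ([:1, - (\<zeta> / of_real (R\<^sup>2)):] * u)"
proof -
  define n where "n = Suc (degree u)"
  have deg: "degree ([:1, - x:] * u) \<le> n" for x
    unfolding n_def by (rule order_trans[OF degree_mult_le]) auto
  let ?c = "\<lambda>x i. coeff ([:1, - x:] * u) i"
  have key: "R\<^sup>2 * (\<Sum>i\<le>k. (R ^ i * cmod (?c (\<zeta> / of_real (R\<^sup>2)) i))\<^sup>2) - (\<Sum>i\<le>k. (R ^ i * cmod (?c \<zeta> i))\<^sup>2)
     = (R\<^sup>2 - 1) * (R ^ k * cmod (coeff u k))\<^sup>2" for k
  proof (induction k)
    case 0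
    then show ?case by (simp add: coeff_linear_mult algebra_simps del: mult_pCons_left)
  next
    case (Suc k)
    have "R\<^sup>2 * (R ^ Suc k * cmod (?c (\<zeta> / of_real (R\<^sup>2)) (Suc k)))\<^sup>2 - (R ^ Suc k * cmod (?c \<zeta> (Suc k)))\<^sup>2
       = (R ^ Suc k)\<^sup>2 * (R\<^sup>2 * (cmod (coeff u (Suc k) - \<zeta> / of_real (R\<^sup>2) * coeff u k))\<^sup>2
            - (cmod (coeff u (Suc k) - \<zeta> * coeff u k))\<^sup>2)"
      by (simp only: coeff_linear_mult nat.case) (simp add: power_mult_distrib algebra_simps)
    also have "\<dots> = (R\<^sup>2 - 1) * ((R ^ Suc k * cmod (coeff u (Suc k)))\<^sup>2 - (R ^ k * cmod (coeff u k))\<^sup>2)"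
      unfolding cmod_blaschke_identity[OF assms] using assms(1)
      by (simp add: field_simps power_mult_distrib)
    finally show ?case using Suc.IH by (simp only: sum.atMost_Suc) (simp add: algebra_simps)
  qed
  have "coeff u n = 0" unfolding n_def by (simp add: coeff_eq_0)
  then have "(\<Sum>i\<le>n. (R ^ i * cmod (?c \<zeta> i))\<^sup>2) = R\<^sup>2 * (\<Sum>i\<le>n. (R ^ i * cmod (?c (\<zeta> / of_real (R\<^sup>2)) i))\<^sup>2)"
    using key[of n] by (simp del: mult_pCons_left)
  then show ?thesis
    unfolding wnorm_eq[OF deg] L2_set_def using assms(1)
    by (simp only: real_sqrt_mult) simp
qed

lemma geometric_poly:
  "[:1, - \<kappa>:] * (\<Sum>j<K. monom (\<kappa> ^ j) j) = 1 - monom (\<kappa> ^ K) K" for \<kappa> :: complex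
proof (induction K)
  case (Suc K)
  have "[:1, - \<kappa>:] * monom (\<kappa> ^ K) K = monom (\<kappa> ^ K) K - monom (\<kappa> ^ Suc K) (Suc K)"
    by (rule poly_eqI) (auto simp: coeff_linear_mult coeff_monom split: nat.split simp del: mult_pCons_left)
  then show ?case using Suc by (simp add: distrib_left del: mult_pCons_left)
qed simp

text \<open>The product of the quotients \<open>(1 - \<zeta> z) / (1 - \<zeta> z / R\<^sup>2)\<close> would have weighted norm \<open>R ^ d\<close>. Truncating each
  geometric series \<open>1 / (1 - \<kappa> z)\<close> after \<open>K\<close> terms keeps everything polynomial and exactly divisible by
  \<open>1 - \<zeta> z\<close>, at the price of a factor \<open>1 + (1 / R) ^ K\<close> per root for the numerator \<open>1 - (\<kappa> z) ^ K\<close>.\<close>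

lemma exists_root_multiple_weighted:
  assumes "R > 1" "K > 0" "\<forall>\<zeta>\<in>#\<Lambda>. cmod \<zeta> = 1"
  shows "\<exists>r. root_poly \<Lambda> dvd r \<and> coeff r 0 = 1 \<and> wnorm R r \<le> (R * (1 + (1 / R) ^ K)) ^ size \<Lambda>"
  using assms(3)
proof (induction \<Lambda>)
  case empty
  show ?case by (rule exI[of _ 1]) (simp add: root_poly_def)
next
  case (add \<zeta> \<Lambda>)
  then obtain r where r: "root_poly \<Lambda> dvd r" "coeff r 0 = 1"
    "wnorm R r \<le> (R * (1 + (1 / R) ^ K)) ^ size \<Lambda>" by auto
  have l: "cmod \<zeta> = 1" using add.prems by simp
  define \<kappa> where "\<kappa> = \<zeta> / of_real (R\<^sup>2)"
  define G where "G = (\<Sum>j<K. monom (\<kappa> ^ j) j)"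
  have G: "[:1, - \<kappa>:] * G = 1 - monom (\<kappa> ^ K) K"
    unfolding G_def by (rule geometric_poly)
  have G0: "coeff G 0 = 1" unfolding G_def coeff_sum using assms(2)
    by (subst sum.remove[of _ 0]) auto
  have "cmod (\<kappa> ^ K) * R ^ K = (1 / R) ^ K"
    using assms(1) l unfolding \<kappa>_def
    by (simp add: norm_mult norm_power norm_divide power_divide field_simps power2_eq_square power_mult_distrib)
  then have m: "wnorm R (monom (\<kappa> ^ K) K * r) = (1 / R) ^ K * wnorm R r"
    using assms(1) by (simp add: wnorm_monom_mult)
  have "wnorm R ([:1, - \<zeta>:] * (G * r)) = R * wnorm R ([:1, - \<kappa>:] * (G * r))"
    unfolding \<kappa>_def using assms(1) l by (intro wnorm_blaschke) auto
  also have "[:1, - \<kappa>:] * (G * r) = r + - (monom (\<kappa> ^ K) K * r)"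
    unfolding mult.assoc[symmetric] G by (simp add: algebra_simps)
  also have "wnorm R \<dots> \<le> wnorm R r + (1 / R) ^ K * wnorm R r"
    using wnorm_add[of R r "- (monom (\<kappa> ^ K) K * r)"] assms(1) m by (simp add: wnorm_minus)
  also have "\<dots> = (1 + (1 / R) ^ K) * wnorm R r" by (simp add: algebra_simps)
  finally have "wnorm R ([:1, - \<zeta>:] * (G * r)) \<le> R * (1 + (1 / R) ^ K) * wnorm R r"
    using assms(1) by (simp del: mult_pCons_left)
  also have "\<dots> \<le> R * (1 + (1 / R) ^ K) * (R * (1 + (1 / R) ^ K)) ^ size \<Lambda>"
    using assms(1) r(3) by (intro mult_left_mono) auto
  finally have 1: "wnorm R ([:1, - \<zeta>:] * (G * r)) \<le> (R * (1 + (1 / R) ^ K)) ^ size (add_mset \<zeta> \<Lambda>)"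
    by (simp del: mult_pCons_left)
  have 2: "coeff ([:1, - \<zeta>:] * (G * r)) 0 = 1"
    using G0 r(2) by (simp add: coeff_mult_0)
  have 3: "root_poly (add_mset \<zeta> \<Lambda>) dvd [:1, - \<zeta>:] * (G * r)"
    unfolding root_poly_def using r(1)[unfolded root_poly_def]
    by (simp del: mult_pCons_left add: mult_dvd_mono)
  from 1 2 3 show ?case by blast
qed

text \<open>As \<open>K\<close> grows, the preceding bound on the squared norm approaches \<open>R ^ (2 * d)\<close>, of which the constant
  term contributes \<open>1\<close>. The factor \<open>2\<close> leaves room for the limit.\<close>

lemma exists_root_multiple_near_1:
  assumes "R > 1" "\<forall>\<zeta>\<in>#\<Lambda>. cmod \<zeta> = 1" "size \<Lambda> > 0"
  shows "\<exists>r. root_poly \<Lambda> dvd r \<and> coeff r 0 = 1 \<and>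
     (\<Sum>i=1..degree r. (R ^ i * cmod (coeff r i))\<^sup>2) \<le> 2 * (R ^ (2 * size \<Lambda>) - 1)"
proof -
  define d where "d = size \<Lambda>"
  have "(\<lambda>K. (R * (1 + (1 / R) ^ K)) ^ (2 * d)) \<longlonglongrightarrow> (R * (1 + 0)) ^ (2 * d)"
    using assms(1) by (intro tendsto_intros LIMSEQ_power_zero) auto
  moreover have "(R * (1 + 0)) ^ (2 * d) < 2 * R ^ (2 * d) - 1"
    using assms(1,3) one_less_power[of R "2 * d"] by (simp add: d_def)
  ultimately have "eventually (\<lambda>K. (R * (1 + (1 / R) ^ K)) ^ (2 * d) < 2 * R ^ (2 * d) - 1) sequentially"
    by (rule order_tendstoD)
  then obtain K where K: "(R * (1 + (1 / R) ^ K)) ^ (2 * d) < 2 * R ^ (2 * d) - 1" "K > 0"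
    by (metis (mono_tags, lifting) eventually_sequentially le_eq_less_or_eq gr0I less_Suc_eq_le linorder_le_cases zero_less_Suc)
  obtain r where r: "root_poly \<Lambda> dvd r" "coeff r 0 = 1" "wnorm R r \<le> (R * (1 + (1 / R) ^ K)) ^ d"
    using exists_root_multiple_weighted[OF assms(1) K(2) assms(2)] d_def by blast
  have "(\<Sum>i\<le>degree r. (R ^ i * cmod (coeff r i))\<^sup>2) = (wnorm R r)\<^sup>2"
    unfolding wnorm_def L2_set_def by (simp add: sum_nonneg)
  also have "\<dots> \<le> ((R * (1 + (1 / R) ^ K)) ^ d)\<^sup>2"
    using r(3) wnorm_nonneg by (intro power_mono) auto
  also have "\<dots> \<le> 2 * R ^ (2 * d) - 1"
    using K(1) by (simp add: power_mult[symmetric] mult.commute)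
  also have "(\<Sum>i\<le>degree r. (R ^ i * cmod (coeff r i))\<^sup>2) = 1 + (\<Sum>i=1..degree r. (R ^ i * cmod (coeff r i))\<^sup>2)"
    using r(2) by (simp add: atMost_atLeast0 sum.atLeast_Suc_atMost)
  finally show ?thesis using r d_def by (intro exI[of _ r]) auto
qed

section \<open>Reducing high powers modulo a root polynomial\<close>

lemma linear_dvd_if_root:
  fixes \<zeta> :: complex
  assumes "\<zeta> \<noteq> 0" "poly P (inverse \<zeta>) = 0"
  shows "[:1, - \<zeta>:] dvd P"
proof -
  have "[:1, - \<zeta>:] = smult (- \<zeta>) [:- inverse \<zeta>, 1:]" using assms(1) by simp
  moreover have "[:- inverse \<zeta>, 1:] dvd P" using assms(2) by (simp add: poly_eq_0_iff_dvd)
  ultimately show ?thesis using assms(1) by (simp add: smult_dvd del: smult_pCons)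
qed

text \<open>For one root, \<open>z ^ (2 * L)\<close> agrees at \<open>1 / \<zeta>\<close> with the average of suitable multiples of \<open>1, z, \<dots>, z ^ (L - 1)\<close>,
  which has \<open>\<ell>\<^sub>1\<close> norm \<open>1\<close> and \<open>\<ell>\<^sub>2\<close> norm \<open>1 / sqrt L\<close>. When these congruences are
  multiplied, each further root replaces the bound \<open>A - 1\<close> on the norms by \<open>2 * A - 1\<close>. The gap of \<open>L\<close> between the leading power and the rest is what limits the growth
  when the congruence is iterated.\<close>

lemma exists_gap_reduction:
  assumes "L \<ge> 1" "\<forall>\<zeta>\<in>#\<Lambda>. cmod \<zeta> = 1"
  shows "\<exists>c. root_poly \<Lambda> dvd monom 1 (size \<Lambda> * (2 * L)) - c
    \<and> (\<forall>i. coeff c i \<noteq> 0 \<longrightarrow> i + L < size \<Lambda> * (2 * L))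
    \<and> onenorm c \<le> 2 ^ size \<Lambda> - 1 \<and> wnorm 1 c \<le> (2 ^ size \<Lambda> - 1) / sqrt (real L)"
  using assms(2)
proof (induction \<Lambda>)
  case empty
  show ?case by (rule exI[of _ 0]) (simp add: root_poly_def)
next
  case (add \<zeta> \<Lambda>)
  define n where "n = size \<Lambda> * (2 * L)"
  define A :: real where "A = 2 ^ size \<Lambda>"
  obtain c where c: "root_poly \<Lambda> dvd monom 1 n - c" "\<And>i. coeff c i \<noteq> 0 \<Longrightarrow> i + L < n"
    "onenorm c \<le> A - 1" "wnorm 1 c \<le> (A - 1) / sqrt (real L)"
    using add unfolding n_def A_def by auto
  have z: "cmod \<zeta> = 1" "\<zeta> \<noteq> 0" using add.prems by auto
  define \<kappa> where "\<kappa> = inverse \<zeta>"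
  define a where "a = (\<Sum>j<L. monom (\<kappa> ^ (2 * L - j) / of_nat L) j)"
  have coeff_a: "coeff a i = (if i < L then \<kappa> ^ (2 * L - i) / of_nat L else 0)" for i
    unfolding a_def coeff_sum coeff_monom by simp
  have deg_a: "degree a \<le> L - 1"
    by (rule degree_le) (auto simp: coeff_a)
  have L: "{..L - 1} = {..<L}" using assms(1) by auto
  have cmod_a: "cmod (coeff a i) = 1 / real L" if "i < L" for i
    using that z by (simp add: coeff_a norm_divide norm_power \<kappa>_def norm_inverse)
  have one_a: "onenorm a \<le> 1"
    unfolding onenorm_eq[OF deg_a] L using assms(1) by (simp add: cmod_a)
  have two_a: "wnorm 1 a \<le> 1 / sqrt (real L)"
    unfolding wnorm_eq[OF deg_a] L L2_set_def using assms(1)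
    by (simp add: cmod_a power2_eq_square real_sqrt_divide)
  have "poly (monom 1 (2 * L) - a) \<kappa> = \<kappa> ^ (2 * L) - (\<Sum>j<L. \<kappa> ^ (2 * L) / of_nat L)"
    unfolding a_def poly_diff poly_sum poly_monom
    by (intro arg_cong2[where f = "(-)"] sum.cong) (auto simp: power_add[symmetric])
  also have "\<dots> = 0" using assms(1) by simp
  finally have dvd_a: "[:1, - \<zeta>:] dvd monom 1 (2 * L) - a"
    unfolding \<kappa>_def by (rule linear_dvd_if_root[OF z(2)])
  define c' where "c' = monom 1 n * a + monom 1 (2 * L) * c + - (a * c)"
  have eq: "(monom 1 (2 * L) - a) * (monom 1 n - c) = monom 1 (size (add_mset \<zeta> \<Lambda>) * (2 * L)) - c'"
    by (simp add: c'_def n_def algebra_simps mult_monom)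
  have 1: "root_poly (add_mset \<zeta> \<Lambda>) dvd monom 1 (size (add_mset \<zeta> \<Lambda>) * (2 * L)) - c'"
    unfolding eq[symmetric] using dvd_a c(1) by (simp add: root_poly_def mult_dvd_mono del: mult_pCons_left)
  have 2: "i + L < size (add_mset \<zeta> \<Lambda>) * (2 * L)" if "coeff c' i \<noteq> 0" for i
  proof -
    have "coeff (monom 1 n * a) i \<noteq> 0 \<or> coeff (monom 1 (2 * L) * c) i \<noteq> 0 \<or> coeff (a * c) i \<noteq> 0"
      using that unfolding c'_def by auto
    then consider "coeff (monom 1 n * a) i \<noteq> 0" | "coeff (monom 1 (2 * L) * c) i \<noteq> 0" | "coeff (a * c) i \<noteq> 0"
      by blast
    then show ?thesis
    proof cases
      case 1
      then show ?thesis by (auto simp: coeff_monom_mult coeff_a n_def split: if_splits)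
    next
      case 2
      then show ?thesis using c(2)[of "i - 2 * L"] by (auto simp: coeff_monom_mult n_def split: if_splits)
    next
      case 3
      then obtain j where "j \<le> i" "coeff a j \<noteq> 0" "coeff c (i - j) \<noteq> 0"
        unfolding coeff_mult by (metis (no_types, lifting) atMost_iff mult_eq_0_iff sum.neutral)
      then show ?thesis using c(2)[of "i - j"] by (auto simp: coeff_a n_def split: if_splits)
    qed
  qed
  have "onenorm c' \<le> onenorm (monom 1 n * a) + onenorm (monom 1 (2 * L) * c) + onenorm (a * c)"
    unfolding c'_def
    using onenorm_add[of "monom 1 n * a + monom 1 (2 * L) * c" "- (a * c)"]
      onenorm_add[of "monom 1 n * a" "monom 1 (2 * L) * c"] by (simp add: onenorm_minus)
  moreover have "onenorm (a * c) \<le> 1 * (A - 1)"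
    by (rule order_trans[OF onenorm_mult]) (intro mult_mono one_a c(3) onenorm_nonneg; simp)
  ultimately have 3: "onenorm c' \<le> 2 ^ size (add_mset \<zeta> \<Lambda>) - 1"
    using one_a c(3) by (simp add: onenorm_monom_mult A_def)
  have "wnorm 1 c' \<le> wnorm 1 (monom 1 n * a) + wnorm 1 (monom 1 (2 * L) * c) + wnorm 1 (a * c)"
    unfolding c'_def
    using wnorm_add[of 1 "monom 1 n * a + monom 1 (2 * L) * c" "- (a * c)"]
      wnorm_add[of 1 "monom 1 n * a" "monom 1 (2 * L) * c"] by (simp add: wnorm_minus)
  moreover have "wnorm 1 (a * c) \<le> 1 * ((A - 1) / sqrt (real L))"
    by (rule order_trans[OF wnorm_mult]) (intro mult_mono one_a c(4) wnorm_nonneg; simp)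
  ultimately have "wnorm 1 c' \<le> 1 / sqrt (real L) + (A - 1) / sqrt (real L) + (A - 1) / sqrt (real L)"
    using two_a c(4) wnorm_monom_mult[of 1 1 n a] wnorm_monom_mult[of 1 1 "2 * L" c]
    by (simp only: norm_one power_one)
  also have "\<dots> = (2 ^ size (add_mset \<zeta> \<Lambda>) - 1) / sqrt (real L)"
    by (simp add: A_def diff_divide_distrib add_divide_distrib)
  finally have 4: "wnorm 1 c' \<le> (2 ^ size (add_mset \<zeta> \<Lambda>) - 1) / sqrt (real L)" .
  from 1 2 3 4 show ?case by blast
qed

text \<open>Replaces every power \<open>z ^ j\<close> of \<open>e\<close> with \<open>j > D\<close> by its representative \<open>C j\<close>.\<close>

definition fold_tail :: "nat \<Rightarrow> (nat \<Rightarrow> complex poly) \<Rightarrow> complex poly \<Rightarrow> complex poly" where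
  "fold_tail D C e = poly_cutoff (Suc D) e + (\<Sum>j\<in>{D<..degree e}. smult (coeff e j) (C j))"

lemma fold_tail_congruent:
  assumes "\<And>j. D < j \<Longrightarrow> j \<le> degree e \<Longrightarrow> p dvd monom 1 j - C j \<and> coeff (C j) 0 = 0 \<and> degree (C j) \<le> D"
  shows "p dvd e - fold_tail D C e" "coeff (fold_tail D C e) 0 = coeff e 0" "degree (fold_tail D C e) \<le> D"
proof -
  have e: "e = poly_cutoff (Suc D) e + (\<Sum>j\<in>{D<..degree e}. smult (coeff e j) (monom 1 j))"
    by (rule poly_eqI) (auto simp: coeff_poly_cutoff coeff_sum smult_monom coeff_eq_0)
  have "e - fold_tail D C e = (\<Sum>j\<in>{D<..degree e}. smult (coeff e j) (monom 1 j - C j))"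
    unfolding fold_tail_def by (subst (1) e) (simp add: sum_subtractf smult_diff_right)
  also have "p dvd \<dots>"
    using assms by (intro dvd_sum dvd_smult) auto
  finally show "p dvd e - fold_tail D C e" .
  show "coeff (fold_tail D C e) 0 = coeff e 0"
    using assms by (auto simp: fold_tail_def coeff_poly_cutoff coeff_sum intro!: sum.neutral)
  show "degree (fold_tail D C e) \<le> D"
    unfolding fold_tail_def
  proof (rule degree_add_le)
    show "degree (poly_cutoff (Suc D) e) \<le> D"
      by (rule degree_le) (auto simp: coeff_poly_cutoff)
    show "degree (\<Sum>j\<in>{D<..degree e}. smult (coeff e j) (C j)) \<le> D"
      using assms by (intro degree_sum_le) (auto intro: order_trans[OF degree_smult_le])
  qed
qed

lemma wnorm_cutoff: "wnorm 1 (poly_cutoff n e) \<le> wnorm 1 e"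
proof -
  have "degree (poly_cutoff n e) \<le> degree e"
    by (rule degree_le) (auto simp: coeff_poly_cutoff coeff_eq_0)
  then show ?thesis
    unfolding wnorm_eq[OF \<open>degree (poly_cutoff n e) \<le> degree e\<close>] unfolding wnorm_def
    by (intro L2_set_mono) (auto simp: coeff_poly_cutoff)
qed

text \<open>Multiplying the congruence for \<open>z ^ D\<close> by \<open>z ^ (t - D)\<close> expresses \<open>z ^ t\<close> by powers that are lower by more than \<open>L\<close>;
  those still above \<open>D\<close> are reduced recursively. Each gain of \<open>L\<close> in the exponent costs at most a factor
  \<open>A \<le> \<tau> ^ L\<close>, whence the growth rate \<open>\<tau>\<close>.\<close>

lemma exists_power_reduction:
  fixes A s \<tau> :: real
  assumes c: "p dvd monom 1 D - c" "\<And>i. coeff c i \<noteq> 0 \<Longrightarrow> i + L < D"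
      "onenorm c \<le> A - 1" "wnorm 1 c \<le> (A - 1) * s"
    and A: "A \<ge> 1" "s \<ge> 0" "\<tau> \<ge> 1" "A \<le> \<tau> ^ L"
    and t: "D < t"
  shows "\<exists>C. p dvd monom 1 t - C \<and> coeff C 0 = 0 \<and> degree C \<le> D \<and> wnorm 1 C \<le> A * s * \<tau> ^ (t - D)"
  using t
proof (induction t rule: less_induct)
  case (less t)
  define e where "e = monom 1 (t - D) * c"
  have ce: "coeff e i \<noteq> 0 \<Longrightarrow> i + L < t \<and> t - D \<le> i" for i
    unfolding e_def coeff_monom_mult using c(2)[of "i - (t - D)"] less.prems by (auto split: if_splits)
  have lt: "j + L < t" if "D < j" "j \<le> degree e" for j
  proof -
    have "e \<noteq> 0" using that by auto
    then have "coeff e (degree e) \<noteq> 0" by simp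
    then show ?thesis using ce[of "degree e"] that by auto
  qed
  have "\<forall>j\<in>{D<..degree e}. \<exists>C. p dvd monom 1 j - C \<and> coeff C 0 = 0 \<and> degree C \<le> D
      \<and> wnorm 1 C \<le> A * s * \<tau> ^ (j - D)"
  proof
    fix j assume "j \<in> {D<..degree e}"
    then have "j < t" "D < j" using lt[of j] by auto
    then show "\<exists>C. p dvd monom 1 j - C \<and> coeff C 0 = 0 \<and> degree C \<le> D
      \<and> wnorm 1 C \<le> A * s * \<tau> ^ (j - D)" by (rule less.IH)
  qed
  then obtain C where C: "\<And>j. j \<in> {D<..degree e} \<Longrightarrow> p dvd monom 1 j - C j \<and> coeff (C j) 0 = 0 \<and>
      degree (C j) \<le> D \<and> wnorm 1 (C j) \<le> A * s * \<tau> ^ (j - D)"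
    by metis
  note props = fold_tail_congruent[of D e p C]
  have split: "monom 1 t - fold_tail D C e = monom 1 (t - D) * (monom 1 D - c) + (e - fold_tail D C e)"
    using less.prems by (simp add: e_def algebra_simps mult_monom)
  then have 1: "p dvd monom 1 t - fold_tail D C e"
    unfolding split using C by (intro dvd_add dvd_mult c(1) props(1)) auto
  have 2: "coeff (fold_tail D C e) 0 = 0"
    using props(2) C ce[of 0] less.prems by force
  have 3: "degree (fold_tail D C e) \<le> D" using props(3) C by auto
  have we: "wnorm 1 (poly_cutoff (Suc D) e) \<le> (A - 1) * s"
    using wnorm_cutoff[of "Suc D" e] c(4) by (simp add: e_def wnorm_monom_mult)
  have oe: "onenorm e \<le> A - 1" using c(3) by (simp add: e_def onenorm_monom_mult)
  let ?tail = "\<Sum>j\<in>{D<..degree e}. smult (coeff e j) (C j)"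
  have "wnorm 1 (fold_tail D C e) \<le> A * s * \<tau> ^ (t - D)"
  proof (cases "{D<..degree e} = {}")
    case True
    then have "fold_tail D C e = poly_cutoff (Suc D) e" unfolding fold_tail_def by simp
    then have "wnorm 1 (fold_tail D C e) \<le> (A - 1) * s" using we by simp
    also have "\<dots> \<le> A * s" using A by (intro mult_right_mono) auto
    also have "\<dots> \<le> A * s * \<tau> ^ (t - D)"
      using A mult_left_mono[of 1 "\<tau> ^ (t - D)" "A * s"] by simp
    finally show ?thesis .
  next
    case False
    then obtain j where "D < j" "j \<le> degree e" by auto
    then have tD: "L \<le> t - D" using lt by fastforce
    then have "\<tau> ^ L \<le> \<tau> ^ (t - D)" using A by (intro power_increasing) auto
    then have At: "A \<le> \<tau> ^ (t - D)" using A by simp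
    have "wnorm 1 ?tail \<le> (\<Sum>j\<in>{D<..degree e}. wnorm 1 (smult (coeff e j) (C j)))"
      by (rule wnorm_sum) simp
    also have "\<dots> \<le> (\<Sum>j\<in>{D<..degree e}. cmod (coeff e j) * (s * \<tau> ^ (t - D)))"
    proof (rule sum_mono)
      fix j assume j: "j \<in> {D<..degree e}"
      have "wnorm 1 (C j) \<le> A * s * \<tau> ^ (j - D)" using C j by blast
      also have "\<dots> \<le> \<tau> ^ L * s * \<tau> ^ (j - D)" using A by (intro mult_right_mono) auto
      also have "\<dots> = s * \<tau> ^ (L + (j - D))" by (simp add: power_add)
      also have "\<dots> \<le> s * \<tau> ^ (t - D)"
        using A lt[of j] j by (intro mult_left_mono power_increasing) auto
      finally show "wnorm 1 (smult (coeff e j) (C j)) \<le> cmod (coeff e j) * (s * \<tau> ^ (t - D))"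
        by (simp add: wnorm_smult mult_left_mono)
    qed
    also have "\<dots> \<le> onenorm e * (s * \<tau> ^ (t - D))"
      unfolding sum_distrib_right[symmetric] onenorm_def using A
      by (intro mult_right_mono sum_mono2) auto
    also have "\<dots> \<le> (A - 1) * (s * \<tau> ^ (t - D))" using oe A by (intro mult_right_mono) auto
    finally have "wnorm 1 (fold_tail D C e) \<le> (A - 1) * s + (A - 1) * (s * \<tau> ^ (t - D))"
      unfolding fold_tail_def using wnorm_add[of 1 "poly_cutoff (Suc D) e" ?tail] we by simp
    also have "\<dots> \<le> \<tau> ^ (t - D) * s + (A - 1) * (s * \<tau> ^ (t - D))"
      using At A by (intro add_right_mono mult_right_mono) auto
    finally show ?thesis by (simp add: algebra_simps)
  qed
  with 1 2 3 show ?case by blast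
qed

lemma two_powr_le_one_plus:
  assumes "0 \<le> x" "x \<le> 1"
  shows "2 powr x \<le> 1 + (x::real)"
proof -
  have "(1 + 1) powr x \<le> 1 + x * (1::real)"
    using assms convex_onD[OF exp_convex, of x 0 "ln 2"] by (simp add: powr_def)
  then show ?thesis by simp
qed

lemma geometric_tail_bound:
  assumes "L \<ge> 1"
  shows "(\<Sum>j\<in>{D<..n}. ((1/2) powr (1 / real L)) ^ (j - D)) \<le> 2 * real L"
proof -
  define x :: real where "x = (1/2) powr (1 / real L)"
  have x: "0 < x" "x < 1" using assms unfolding x_def by (auto simp: powr_def ln_div divide_neg_pos)
  have "1 / x = 2 powr (1 / real L)" unfolding x_def by (simp add: powr_divide)
  also have "\<dots> \<ge> 1 + ln 2 * (1 / real L)"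
    using exp_ge_add_one_self[of "ln 2 * (1 / real L)"] by (simp add: powr_def)
  finally have "1 / x - 1 \<ge> ln 2 / real L" by simp
  moreover have "ln 2 / real L \<ge> 1 / (2 * real L)"
    using ln2_ge_two_thirds assms by (simp add: field_simps)
  ultimately have g: "1 / x - 1 \<ge> 1 / (2 * real L)" by linarith
  have "(\<Sum>j\<in>{D<..n}. x ^ (j - D)) = (\<Sum>i<n - D. x ^ Suc i)"
    by (rule sum.reindex_bij_witness[of _ "\<lambda>i. i + Suc D" "\<lambda>j. j - Suc D"]) (auto simp: Suc_diff_Suc simp flip: power_Suc)
  also have "\<dots> = x * ((1 - x ^ (n - D)) / (1 - x))"
    using x sum_gp_strict[of x "n - D"] by (simp only: power_Suc sum_distrib_left[symmetric]) simp
  also have "\<dots> \<le> x * (1 / (1 - x))"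
    using x by (intro mult_left_mono divide_right_mono) auto
  also have "\<dots> = 1 / (1 / x - 1)" using x by (simp add: field_simps)
  also have "\<dots> \<le> 2 * real L" using g assms frac_le[of 1 1 "1 / (2 * real L)" "1 / x - 1"] by simp
  finally show ?thesis unfolding x_def .
qed

section \<open>Short reproducing filters\<close>

text \<open>Fold the multiple \<open>r\<close> of the root polynomial at degree \<open>D = 2 * d * L\<close>. Its coefficients have weighted
  \<open>\<ell>\<^sub>2\<close> norm \<open>E\<close> of order \<open>d / sqrt L\<close>. The part up to degree \<open>D\<close> contributes at most \<open>E\<close>. By Cauchy-Schwarz the
  folded tail contributes at most \<open>E\<close> times the norm of \<open>A * s * \<tau> ^ (j - D) / R ^ j\<close>, and \<open>R\<close> is chosen so that
  this sequence decays like \<open>2 powr (- j / (2 * L))\<close> from an initial value below \<open>s = 1 / sqrt L\<close>, so that its norm is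
  at most \<open>sqrt 2\<close>. The condition on \<open>L\<close> keeps \<open>R ^ (2 * d)\<close> at most \<open>2\<close>.\<close>

lemma exists_reproducing_filter:
  assumes "\<forall>\<zeta>\<in>#\<Lambda>. cmod \<zeta> = 1" "size \<Lambda> = d" "d \<ge> 1" "L \<ge> d * (2 * d + 1)"
  shows "\<exists>q. root_poly \<Lambda> dvd 1 - q \<and> coeff q 0 = 0 \<and> degree q \<le> 2 * d * L
    \<and> (wnorm 1 q)\<^sup>2 \<le> 36 * real d ^ 2 / real L"
proof -
  define D where "D = d * (2 * L)"
  define A :: real where "A = 2 ^ d"
  define s where "s = 1 / sqrt (real L)"
  define \<tau> :: real where "\<tau> = 2 powr (real d / real L)"
  \<comment> \<open>The extra \<open>1 / (2 * L)\<close> in the exponent makes \<open>R\<^sup>2\<close> exceed \<open>\<tau>\<^sup>2\<close> by the factor \<open>2 powr (1 / L)\<close>.\<close>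
  define R :: real where "R = 2 powr (real (2 * d + 1) / (2 * real L))"
  have "1 * 1 \<le> d * (2 * d + 1)" using assms(3) by (intro mult_le_mono) auto
  then have L1: "L \<ge> 1" using assms(4) by simp
  then have Lpos: "real L > 0" by simp
  have Rpow: "R ^ n = 2 powr (real n * (real (2 * d + 1) / (2 * real L)))" for n
    unfolding R_def by (simp add: powr_power mult.commute)
  have taupow: "\<tau> ^ n = 2 powr (real n * (real d / real L))" for n
    unfolding \<tau>_def by (simp add: powr_power mult.commute)
  have R1: "R > 1" unfolding R_def using Lpos by (simp add: gr_one_powr)
  have t1: "\<tau> \<ge> 1" unfolding \<tau>_def by (intro ge_one_powr_ge_zero) auto
  have AL: "A = \<tau> ^ L" unfolding taupow A_def using Lpos by (simp add: powr_realpow)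

  obtain r where r: "root_poly \<Lambda> dvd r" "coeff r 0 = 1"
      "(\<Sum>i=1..degree r. (R ^ i * cmod (coeff r i))\<^sup>2) \<le> 2 * (R ^ (2 * d) - 1)"
    using exists_root_multiple_near_1[OF R1 assms(1)] assms(2,3) by auto
  define E where "E = L2_set (\<lambda>i. R ^ i * cmod (coeff r i)) {1..degree r}"
  have E0: "E \<ge> 0" unfolding E_def by simp
  have le: "real d * (2 * real d + 1) \<le> real L"
    using assms(4)[folded of_nat_le_iff[where 'a = real]] by (simp add: algebra_simps)
  have "R ^ (2 * d) = 2 powr (real d * (2 * real d + 1) / real L)"
  proof -
    have "real (2 * d) * (real (2 * d + 1) / (2 * real L)) = real d * (2 * real d + 1) / real L"
      using Lpos by (simp add: field_simps)
    then show ?thesis unfolding Rpow by (simp only:)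
  qed
  also have "\<dots> \<le> 1 + real d * (2 * real d + 1) / real L"
    using le Lpos by (intro two_powr_le_one_plus) auto
  also have "real d * (2 * real d + 1) \<le> 3 * real d ^ 2"
    using assms(3) by (simp add: power2_eq_square algebra_simps)
  finally have "R ^ (2 * d) \<le> 1 + 3 * real d ^ 2 / real L"
    using Lpos by (simp add: divide_right_mono)
  then have "E\<^sup>2 \<le> 2 * (3 * real d ^ 2 / real L)"
    using r(3) unfolding E_def L2_set_def by (simp add: sum_nonneg)
  then have E2: "E\<^sup>2 \<le> 6 * real d ^ 2 / real L" by simp

  obtain c where c: "root_poly \<Lambda> dvd monom 1 D - c" "\<And>i. coeff c i \<noteq> 0 \<Longrightarrow> i + L < D"
      "onenorm c \<le> A - 1" "wnorm 1 c \<le> (A - 1) * s"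
    using exists_gap_reduction[OF L1 assms(1)] unfolding assms(2) D_def A_def s_def by auto
  have A1: "A \<ge> 1" unfolding A_def by simp
  have s0: "s \<ge> 0" unfolding s_def by simp
  have "\<forall>t\<in>{D<..}. \<exists>C. root_poly \<Lambda> dvd monom 1 t - C \<and> coeff C 0 = 0 \<and> degree C \<le> D
      \<and> wnorm 1 C \<le> A * s * \<tau> ^ (t - D)"
    using exists_power_reduction[OF c A1 s0 t1] AL by simp
  then obtain C where C: "\<And>t. t > D \<Longrightarrow> root_poly \<Lambda> dvd monom 1 t - C t \<and> coeff (C t) 0 = 0
      \<and> degree (C t) \<le> D \<and> wnorm 1 (C t) \<le> A * s * \<tau> ^ (t - D)"
    by (metis greaterThan_iff)
  note props = fold_tail_congruent[of D r "root_poly \<Lambda>" C]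
  define r' where "r' = fold_tail D C r"
  define q where "q = 1 - r'"
  have "root_poly \<Lambda> dvd r - r'" unfolding r'_def using C by (intro props(1)) auto
  then have 1: "root_poly \<Lambda> dvd 1 - q" unfolding q_def using r(1) dvd_diff[of "root_poly \<Lambda>" r "r - r'"] by simp
  have "coeff r' 0 = 1" unfolding r'_def using C props(2) r(2) by auto
  then have 2: "coeff q 0 = 0" unfolding q_def by simp
  have "degree r' \<le> D" unfolding r'_def using C by (intro props(3)) auto
  then have 3: "degree q \<le> 2 * d * L"
    unfolding q_def D_def by (intro degree_diff_le) auto

  let ?head = "poly_cutoff (Suc D) r"
  let ?tail = "\<Sum>j\<in>{D<..degree r}. smult (coeff r j) (C j)"
  have "degree (1 - ?head) \<le> degree r"
    by (intro degree_diff_le) (auto intro!: degree_le simp: coeff_poly_cutoff coeff_eq_0)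
  then have "wnorm 1 (1 - ?head) = L2_set (\<lambda>i. cmod (coeff (1 - ?head) i)) {..degree r}"
    by (simp add: wnorm_eq)
  also have "\<dots> = L2_set (\<lambda>i. cmod (coeff (1 - ?head) i)) {1..degree r}"
    unfolding L2_set_def using r(2)
    by (intro arg_cong[where f = sqrt] sum.mono_neutral_right) (auto simp: coeff_poly_cutoff Suc_le_eq)
  also have "\<dots> \<le> E"
    unfolding E_def
  proof (rule L2_set_mono)
    fix i assume "i \<in> {1..degree r}"
    then have "cmod (coeff (1 - ?head) i) \<le> 1 * cmod (coeff r i)" by (simp add: coeff_poly_cutoff)
    also have "\<dots> \<le> R ^ i * cmod (coeff r i)"
      using R1 by (intro mult_right_mono one_le_power) auto
    finally show "cmod (coeff (1 - ?head) i) \<le> R ^ i * cmod (coeff r i)" .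
  qed simp
  finally have head: "wnorm 1 (1 - ?head) \<le> E" .

  define g where "g j = A * s * \<tau> ^ (j - D) / R ^ j" for j
  have g0: "g j \<ge> 0" for j unfolding g_def using A1 s0 t1 R1 by simp
  have gbound: "(g j)\<^sup>2 \<le> s\<^sup>2 * ((1/2) powr (1 / real L)) ^ (j - D)" if "j > D" for j
  proof -
    define k where "k = j - D"
    have j: "j = D + k" using that unfolding k_def by simp
    define e1 where "e1 = real d + real k * (real d / real L)"
    define e2 where "e2 = real j * (real (2 * d + 1) / (2 * real L))"
    define e3 where "e3 = real k * (- (1 / real L))"
    have "A * \<tau> ^ k = 2 powr e1"
      unfolding A_def taupow e1_def powr_add by (simp add: powr_realpow)
    then have "(A * \<tau> ^ k)\<^sup>2 = 2 powr (e1 + e1)" unfolding powr_add by (simp only: power2_eq_square)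
    also have "\<dots> \<le> 2 powr ((e2 + e2) + e3)"
    proof (rule powr_mono)
      have "real d \<ge> 1" using assms(3) by simp
      \<comment> \<open>\<open>R ^ (2 * D)\<close> alone already outweighs \<open>A\<^sup>2 = 2 ^ (2 * d)\<close>.\<close>
      then have "2 * real d * 1 \<le> 2 * real d * (2 * real d + 1)"
        by (intro mult_left_mono) auto
      moreover have "(e2 + e2) + e3 = 2 * real d * (2 * real d + 1) + 2 * (real k * (real d / real L))"
        using Lpos unfolding e2_def e3_def j D_def by (simp add: field_simps)
      moreover have "e1 + e1 = 2 * real d * 1 + 2 * (real k * (real d / real L))"
        unfolding e1_def by simp
      ultimately show "e1 + e1 \<le> (e2 + e2) + e3" by (simp only: add_le_cancel_right)
    qed simp
    also have "\<dots> = (2 powr e2)\<^sup>2 * 2 powr e3" unfolding powr_add by (simp only: power2_eq_square)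
    also have "2 powr e3 = ((1/2) powr (1 / real L)) ^ k"
    proof -
      have "(1/2) powr (1 / real L) = 2 powr (- (1 / real L))"
        unfolding powr_minus by (simp add: powr_divide inverse_eq_divide)
      then show ?thesis unfolding e3_def by (simp add: powr_power mult.commute)
    qed
    also have "2 powr e2 = R ^ j" unfolding Rpow e2_def ..
    finally have "(A * \<tau> ^ k)\<^sup>2 \<le> (R ^ j)\<^sup>2 * ((1/2) powr (1 / real L)) ^ k" .
    then have "(A * \<tau> ^ k)\<^sup>2 / (R ^ j)\<^sup>2 \<le> ((1/2) powr (1 / real L)) ^ k"
      using R1 by (simp add: pos_divide_le_eq mult.commute)
    then have "s\<^sup>2 * ((A * \<tau> ^ k)\<^sup>2 / (R ^ j)\<^sup>2) \<le> s\<^sup>2 * ((1/2) powr (1 / real L)) ^ k"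
      by (rule mult_left_mono) simp
    then show ?thesis
      unfolding g_def k_def by (simp add: power_mult_distrib power_divide mult_ac)
  qed
  have "(\<Sum>j\<in>{D<..degree r}. (g j)\<^sup>2) \<le> s\<^sup>2 * (\<Sum>j\<in>{D<..degree r}. ((1/2) powr (1 / real L)) ^ (j - D))"
    unfolding sum_distrib_left by (intro sum_mono gbound) auto
  also have "\<dots> \<le> s\<^sup>2 * (2 * real L)"
    by (intro mult_left_mono geometric_tail_bound L1) auto
  also have "\<dots> = 2" unfolding s_def using Lpos by (simp add: power_divide)
  finally have g2: "L2_set g {D<..degree r} \<le> sqrt 2"
    unfolding L2_set_def by (rule real_sqrt_le_mono)
  have "wnorm 1 ?tail \<le> (\<Sum>j\<in>{D<..degree r}. wnorm 1 (smult (coeff r j) (C j)))"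
    by (rule wnorm_sum) simp
  also have "\<dots> \<le> (\<Sum>j\<in>{D<..degree r}. \<bar>R ^ j * cmod (coeff r j)\<bar> * \<bar>g j\<bar>)"
  proof (rule sum_mono)
    fix j assume "j \<in> {D<..degree r}"
    then have "wnorm 1 (smult (coeff r j) (C j)) \<le> cmod (coeff r j) * (A * s * \<tau> ^ (j - D))"
      using C[of j] by (simp add: wnorm_smult mult_left_mono)
    then show "wnorm 1 (smult (coeff r j) (C j)) \<le> \<bar>R ^ j * cmod (coeff r j)\<bar> * \<bar>g j\<bar>"
      using R1 abs_of_nonneg[OF g0[of j]] by (simp add: g_def)
  qed
  also have "\<dots> \<le> L2_set (\<lambda>j. R ^ j * cmod (coeff r j)) {D<..degree r} * L2_set g {D<..degree r}"
    by (rule L2_set_mult_ineq)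
  also have "\<dots> \<le> E * sqrt 2"
  proof (intro mult_mono g2 E0)
    show "L2_set (\<lambda>j. R ^ j * cmod (coeff r j)) {D<..degree r} \<le> E"
      unfolding E_def L2_set_def by (intro real_sqrt_le_mono sum_mono2) auto
  qed simp
  finally have tail: "wnorm 1 ?tail \<le> E * sqrt 2" .
  have "q = (1 - ?head) + - ?tail" unfolding q_def r'_def fold_tail_def by simp
  then have "wnorm 1 q \<le> wnorm 1 (1 - ?head) + wnorm 1 ?tail"
    using wnorm_add[of 1 "1 - ?head" "- ?tail"] by (simp add: wnorm_minus)
  also have "\<dots> \<le> E * (1 + sqrt 2)" using head tail by (simp add: algebra_simps)
  finally have "(wnorm 1 q)\<^sup>2 \<le> (E * (1 + sqrt 2))\<^sup>2"
    using wnorm_nonneg by (intro power_mono) auto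
  also have "\<dots> = E\<^sup>2 * (3 + 2 * sqrt 2)" by (simp add: power2_eq_square algebra_simps)
  also have "\<dots> \<le> E\<^sup>2 * 6"
    using real_le_lsqrt[of "3/2" 2] by (intro mult_left_mono) (auto simp: power2_eq_square)
  also have "\<dots> \<le> 36 * real d ^ 2 / real L" using E2 by simp
  finally show ?thesis using 1 2 3 by blast
qed

section \<open>Filters acting on signals\<close>

text \<open>The operation \<open>apply_shift\<close> extended to complex signals, which arise as partial solutions for single roots.\<close>

definition filt :: "complex poly \<Rightarrow> (int \<Rightarrow> complex) \<Rightarrow> int \<Rightarrow> complex" where
  "filt P f t = (\<Sum>i\<le>degree P. coeff P i * f (t - int i))"

lemma filt_eq:
  assumes "degree P \<le> n"
  shows "filt P f t = (\<Sum>i\<le>n. coeff P i * f (t - int i))"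
  unfolding filt_def
  by (rule sum.mono_neutral_left) (use assms in \<open>auto simp: coeff_eq_0\<close>)

lemma filt_add: "filt (P + Q) f t = filt P f t + filt Q f t"
proof -
  define n where "n = max (degree P) (degree Q)"
  have "degree P \<le> n" "degree Q \<le> n" "degree (P + Q) \<le> n"
    by (auto simp: n_def degree_add_le_max)
  then show ?thesis by (simp add: filt_eq[of _ n] sum.distrib distrib_right)
qed

lemma filt_smult: "filt (smult c P) f t = c * filt P f t"
  unfolding filt_eq[OF degree_smult_le] by (simp add: filt_def sum_distrib_left mult.assoc)

lemma filt_1 [simp]: "filt 1 f = f"
  by (simp add: filt_def fun_eq_iff)

lemma filt_add_right: "filt P (\<lambda>t. f t + g t) t = filt P f t + filt P g t"
  by (simp add: filt_def sum.distrib distrib_left)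

lemma filt_diff_right: "filt P (\<lambda>t. f t - g t) t = filt P f t - filt P g t"
  by (simp add: filt_def sum_subtractf right_diff_distrib)

lemma filt_pCons: "filt (pCons a P) f t = a * f t + filt P f (t - 1)"
proof -
  have "filt (pCons a P) f t = (\<Sum>i\<le>Suc (degree P). coeff (pCons a P) i * f (t - int i))"
    by (rule filt_eq) (simp add: degree_pCons_le)
  also have "\<dots> = a * f t + (\<Sum>i\<le>degree P. coeff P i * f (t - int (Suc i)))"
    by (subst sum.atMost_Suc_shift) simp
  finally show ?thesis unfolding filt_def by (simp add: algebra_simps)
qed

lemma filt_mult: "filt (P * Q) f t = filt P (filt Q f) t"
proof (induction P arbitrary: t)
  case 0
  show ?case by (simp add: filt_def)
next
  case (pCons a P)
  have "filt (pCons a P * Q) f t = a * filt Q f t + filt (pCons 0 (P * Q)) f t"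
    by (simp add: mult_pCons_left filt_add filt_smult)
  also have "\<dots> = filt (pCons a P) (filt Q f) t"
    by (simp add: filt_pCons pCons.IH)
  finally show ?case .
qed

lemma degree_root_poly_le: "degree (root_poly \<Lambda>) \<le> size \<Lambda>"
proof (induction \<Lambda>)
  case (add \<zeta> \<Lambda>)
  have "degree ([:1, - \<zeta>:] * root_poly \<Lambda>) \<le> degree [:1, - \<zeta>:] + degree (root_poly \<Lambda>)"
    by (rule degree_mult_le)
  also have "\<dots> \<le> 1 + size \<Lambda>" using add by (intro add_mono) auto
  finally show ?case by (simp add: root_poly_def del: mult_pCons_left)
qed (simp add: root_poly_def)

lemma root_poly_nz: "root_poly \<Lambda> \<noteq> 0"
  by (induction \<Lambda>) (auto simp: root_poly_def simp del: mult_pCons_left)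

lemma coeff_root_poly_0: "coeff (root_poly \<Lambda>) 0 = 1"
  by (induction \<Lambda>) (auto simp: root_poly_def coeff_mult_0 simp del: mult_pCons_left)

lemma degree_root_poly: "0 \<notin># \<Lambda> \<Longrightarrow> degree (root_poly \<Lambda>) = size \<Lambda>"
proof (induction \<Lambda>)
  case (add \<zeta> \<Lambda>)
  have "degree ([:1, - \<zeta>:] * root_poly \<Lambda>) = degree [:1, - \<zeta>:] + degree (root_poly \<Lambda>)"
    by (rule degree_mult_eq) (auto simp: root_poly_nz)
  then show ?case using add by (simp add: root_poly_def del: mult_pCons_left)
qed (simp add: root_poly_def)

text \<open>The hypothesis on the degrees ensures that the quotient \<open>r div p\<close> only looks at times where the recurrence
  of order \<open>degree p\<close> is known to hold.\<close>

lemma filt_multiple_eq_0: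
  assumes "p dvd r" "r \<noteq> 0" "\<And>s. a \<le> s \<Longrightarrow> s \<le> t \<Longrightarrow> filt p f s = 0" "a + int (degree r) \<le> t + int (degree p)"
  shows "filt r f t = 0"
proof -
  obtain h where h: "r = h * p" using assms(1) by (metis dvdE mult.commute)
  then have "degree r = degree h + degree p" using assms(2) by (auto simp: degree_mult_eq)
  then have "filt p f (t - int i) = 0" if "i \<le> degree h" for i
    using that assms(4) by (intro assms(3)) auto
  then show ?thesis unfolding h filt_mult by (simp add: filt_def[of h])
qed

text \<open>Time reversal of signals reflects the polynomial. On the unit circle \<open>cnj \<zeta> = 1 / \<zeta>\<close>, so the reflection is
  again a root polynomial, for the conjugate roots.\<close>

lemma reflect_root_poly:
  assumes "\<forall>\<zeta>\<in>#\<Lambda>. cmod \<zeta> = 1"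
  shows "\<exists>c. c \<noteq> 0 \<and> reflect_poly (root_poly \<Lambda>) = smult c (root_poly (image_mset cnj \<Lambda>))"
  using assms
proof (induction \<Lambda>)
  case empty
  show ?case by (rule exI[of _ 1]) (simp add: root_poly_def)
next
  case (add \<zeta> \<Lambda>)
  then obtain c where c: "c \<noteq> 0" "reflect_poly (root_poly \<Lambda>) = smult c (root_poly (image_mset cnj \<Lambda>))"
    by auto
  have z: "cmod \<zeta> = 1" using add.prems by simp
  then have z0: "\<zeta> \<noteq> 0" and zc: "\<zeta> * cnj \<zeta> = 1" by (auto simp: complex_norm_square[symmetric])
  have "reflect_poly [:1, - \<zeta>:] = smult (- \<zeta>) [:1, - cnj \<zeta>:]"
    using z0 zc by (simp add: reflect_poly_pCons)
  then have "reflect_poly ([:1, - \<zeta>:] * root_poly \<Lambda>)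
      = smult (- \<zeta> * c) ([:1, - cnj \<zeta>:] * root_poly (image_mset cnj \<Lambda>))"
    unfolding reflect_poly_mult c(2) by (simp only: mult_smult_left mult_smult_right smult_smult mult.commute[of c])
  then have "reflect_poly (root_poly (add_mset \<zeta> \<Lambda>)) = smult (- \<zeta> * c) (root_poly (image_mset cnj (add_mset \<zeta> \<Lambda>)))"
    unfolding root_poly_def by (simp del: mult_pCons_left smult_pCons)
  then show ?case using c(1) z0 by (intro exI[of _ "- \<zeta> * c"]) simp
qed

lemma filt_reversal:
  assumes "coeff p 0 \<noteq> 0"
  shows "filt p (\<lambda>s. f (n - s)) t = filt (reflect_poly p) f (n - t + int (degree p))"
proof -
  have "filt (reflect_poly p) f (n - t + int (degree p))
     = (\<Sum>i\<le>degree p. coeff p (degree p - i) * f (n - t + int (degree p) - int i))"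
    using assms by (simp add: filt_def coeff_reflect_poly)
  also have "\<dots> = (\<Sum>i\<le>degree p. coeff p i * f (n - (t - int i)))"
    by (rule sum.reindex_bij_witness[of _ "\<lambda>i. degree p - i" "\<lambda>i. degree p - i"])
      (auto simp: of_nat_diff algebra_simps)
  finally show ?thesis unfolding filt_def ..
qed

text \<open>One root at a time, the recurrence \<open>v t - \<zeta> * v (t - 1) = e t\<close> is solved by summation from the start, which
  multiplies the bound on the block by at most \<open>N\<close>.\<close>

lemma exists_filter_preimage:
  assumes "\<forall>\<zeta>\<in>#\<Lambda>. cmod \<zeta> = 1" "\<And>t. 0 \<le> t \<Longrightarrow> t < int N \<Longrightarrow> cmod (e t) \<le> \<delta>" "\<And>t. t < 0 \<Longrightarrow> e t = 0" "\<delta> \<ge> 0"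
  shows "\<exists>v. (\<forall>t. filt (root_poly \<Lambda>) v t = e t) \<and> (\<forall>t<0. v t = 0)
     \<and> (\<forall>t\<ge>0. t < int N \<longrightarrow> cmod (v t) \<le> real N ^ size \<Lambda> * \<delta>)"
  using assms
proof (induction \<Lambda> arbitrary: e \<delta>)
  case empty
  then show ?case by (intro exI[of _ e]) (auto simp: root_poly_def)
next
  case (add \<zeta> \<Lambda>)
  have z: "cmod \<zeta> = 1" using add.prems by simp
  define g where "g n = (\<Sum>j\<le>n. \<zeta> ^ (n - j) * e (int j))" for n
  define e' where "e' t = (if t < 0 then 0 else g (nat t))" for t
  have gS: "g (Suc n) = \<zeta> * g n + e (int (Suc n))" for n
    unfolding g_def by (simp add: sum_distrib_left Suc_diff_le mult.assoc)
  have rec: "e' t - \<zeta> * e' (t - 1) = e t" for t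
  proof (cases "t \<le> 0")
    case True
    then show ?thesis using add.prems(3)[of t] by (auto simp: e'_def g_def)
  next
    case False
    then obtain n where n: "t = int (Suc n)" by (metis not0_implies_Suc not_le of_nat_0 zero_less_imp_eq_int less_irrefl)
    then show ?thesis using gS[of n] by (simp add: e'_def nat_add_distrib)
  qed
  have bound: "cmod (e' t) \<le> real N * \<delta>" if "0 \<le> t" "t < int N" for t
  proof -
    have "cmod (g (nat t)) \<le> (\<Sum>j\<le>nat t. cmod (\<zeta> ^ (nat t - j) * e (int j)))"
      unfolding g_def by (rule norm_sum)
    also have "\<dots> \<le> (\<Sum>j\<le>nat t. \<delta>)"
      using that z by (intro sum_mono) (auto simp: norm_mult norm_power intro!: add.prems(2))
    also have "\<dots> \<le> real N * \<delta>"
    proof -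
      have "Suc (nat t) \<le> N" using that by linarith
      then have "real (Suc (nat t)) * \<delta> \<le> real N * \<delta>" using add.prems(4) by (intro mult_right_mono) auto
      then show ?thesis by simp
    qed
    finally show ?thesis using that by (simp add: e'_def)
  qed
  have "\<exists>v. (\<forall>t. filt (root_poly \<Lambda>) v t = e' t) \<and> (\<forall>t<0. v t = 0)
     \<and> (\<forall>t\<ge>0. t < int N \<longrightarrow> cmod (v t) \<le> real N ^ size \<Lambda> * (real N * \<delta>))"
    by (rule add.IH) (use add.prems bound in \<open>auto simp: e'_def\<close>)
  then obtain v where v: "\<And>t. filt (root_poly \<Lambda>) v t = e' t" "\<And>t. t < 0 \<Longrightarrow> v t = 0"
     "\<And>t. 0 \<le> t \<Longrightarrow> t < int N \<Longrightarrow> cmod (v t) \<le> real N ^ size \<Lambda> * (real N * \<delta>)" by blast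
  have "filt (root_poly (add_mset \<zeta> \<Lambda>)) v t = e t" for t
  proof -
    have "filt (root_poly (add_mset \<zeta> \<Lambda>)) v t = filt ([:1, - \<zeta>:] * root_poly \<Lambda>) v t"
      by (simp add: root_poly_def del: mult_pCons_left)
    also have "\<dots> = filt [:1, - \<zeta>:] e' t"
      unfolding filt_mult using v(1) by (simp add: filt_def[of "[:1, - \<zeta>:]"])
    also have "\<dots> = e t" using rec[of t] by (simp add: filt_pCons) (simp add: filt_def)
    finally show ?thesis .
  qed
  then show ?case using v(2,3) by (intro exI[of _ v]) (auto simp: mult_ac)
qed

section \<open>The discrete Fourier transform\<close>

lemma unity_roots_props:
  assumes "N \<ge> 1"
  shows "finite (unity_roots N)" "1 \<in> unity_roots N" "\<mu> \<in> unity_roots N \<Longrightarrow> cmod \<mu> = 1"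
    "card (unity_roots N) = N"
proof -
  have pos: "N > 0" using assms by simp
  show "finite (unity_roots N)" unfolding unity_roots_def using assms by (intro finite_roots_unity) auto
  show "1 \<in> unity_roots N" by (simp add: unity_roots_def)
  show "card (unity_roots N) = N" unfolding unity_roots_def using pos by (rule card_roots_unity_eq)
  assume "\<mu> \<in> unity_roots N"
  then have "cmod \<mu> ^ N = 1" by (simp add: unity_roots_def norm_power[symmetric])
  then show "cmod \<mu> = 1" using pos power_eq_imp_eq_base[of "cmod \<mu>" N 1] by simp
qed

lemma DFT_le_DFT_norm: "N \<ge> 1 \<Longrightarrow> \<mu> \<in> unity_roots N \<Longrightarrow> cmod (DFT N f \<mu>) \<le> DFT_norm N f"
  unfolding DFT_norm_def using unity_roots_props(1) by (intro Max_ge) auto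

lemma DFT_norm_le:
  assumes "N \<ge> 1" "\<And>\<mu>. \<mu> \<in> unity_roots N \<Longrightarrow> cmod (DFT N f \<mu>) \<le> B"
  shows "DFT_norm N f \<le> B"
  unfolding DFT_norm_def using unity_roots_props(1,2)[OF assms(1)] assms(2) by (subst Max_le_iff) auto

lemma DFT_norm_nonneg: "N \<ge> 1 \<Longrightarrow> DFT_norm N f \<ge> 0"
  using DFT_le_DFT_norm[of N 1 f] unity_roots_props(2)[of N] norm_ge_zero order_trans by blast

lemma DFT_add: "DFT N (\<lambda>t. f t + g t) \<mu> = DFT N f \<mu> + DFT N g \<mu>"
  by (simp add: DFT_def sum.distrib distrib_left distrib_right)

lemma DFT_uminus: "DFT N (\<lambda>t. - f t) \<mu> = - DFT N f \<mu>"
  by (simp add: DFT_def sum_negf)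

lemma DFT_norm_triangle:
  assumes "N \<ge> 1"
  shows "DFT_norm N (\<lambda>t. f t + g t) \<le> DFT_norm N f + DFT_norm N g"
proof (rule DFT_norm_le[OF assms])
  fix \<mu> assume "\<mu> \<in> unity_roots N"
  then show "cmod (DFT N (\<lambda>t. f t + g t) \<mu>) \<le> DFT_norm N f + DFT_norm N g"
    unfolding DFT_add using assms by (intro norm_triangle_mono DFT_le_DFT_norm)
qed

lemma DFT_norm_uminus: "DFT_norm N (\<lambda>t. - f t) = DFT_norm N f"
  unfolding DFT_norm_def DFT_uminus by simp

lemma DFT_cong: "(\<And>t. t < N \<Longrightarrow> f t = g t) \<Longrightarrow> DFT N f \<mu> = DFT N g \<mu>"
  by (simp add: DFT_def)

lemma DFT_norm_cong: "(\<And>t. t < N \<Longrightarrow> f t = g t) \<Longrightarrow> DFT_norm N f = DFT_norm N g"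
  unfolding DFT_norm_def using DFT_cong[of N f g] by simp

lemma DFT_norm_le_sup:
  assumes "N \<ge> 1" "\<And>t. t < N \<Longrightarrow> cmod (f t) \<le> B"
  shows "DFT_norm N f \<le> sqrt (real N) * B"
proof (rule DFT_norm_le[OF assms(1)])
  fix \<mu> assume mu: "\<mu> \<in> unity_roots N"
  have "cmod (\<Sum>t<N. f t * \<mu> ^ t) \<le> (\<Sum>t<N. B)"
    by (rule sum_norm_le)
      (use assms unity_roots_props(3)[OF assms(1) mu] in \<open>auto simp: norm_mult norm_power\<close>)
  then have "cmod (DFT N f \<mu>) \<le> 1 / sqrt (real N) * (real N * B)"
    unfolding DFT_def norm_mult by (intro mult_mono) (auto simp: norm_divide)
  also have "\<dots> = real N / sqrt (real N) * B" by simp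
  also have "real N / sqrt (real N) = sqrt (real N)" by (simp add: real_div_sqrt)
  finally show "cmod (DFT N f \<mu>) \<le> sqrt (real N) * B" .
qed

text \<open>Multiplication by the primitive root \<open>\<omega>\<close> permutes the roots of unity and multiplies the sum by
  \<open>\<omega> ^ k * cnj \<omega> ^ j\<close>, which differs from \<open>1\<close> for \<open>j \<noteq> k\<close>.\<close>

lemma unity_roots_orthogonality:
  assumes "N \<ge> 1" "j < N" "k < N"
  shows "(\<Sum>\<mu>\<in>unity_roots N. \<mu> ^ k * cnj \<mu> ^ j) = (if j = k then of_nat N else 0)"
proof (cases "j = k")
  case True
  have "\<mu> ^ k * cnj \<mu> ^ k = 1" if "\<mu> \<in> unity_roots N" for \<mu>
    using unity_roots_props(3)[OF assms(1) that]
    by (simp add: power_mult_distrib[symmetric] complex_norm_square[symmetric])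
  then have "(\<Sum>\<mu>\<in>unity_roots N. \<mu> ^ k * cnj \<mu> ^ j) = (\<Sum>\<mu>\<in>unity_roots N. 1)"
    using True by (intro sum.cong) auto
  then show ?thesis using True unity_roots_props(4)[OF assms(1)] by simp
next
  case False
  define \<omega> where "\<omega> = cis (2 * pi / real N)"
  have pw: "\<omega> ^ i = cis (2 * pi * real i / real N)" for i
    unfolding \<omega>_def Complex.DeMoivre by (simp add: mult_ac)
  have wN: "\<omega> ^ N = 1" unfolding pw using assms(1) by (simp add: cis_2pi)
  have "inj_on (\<lambda>i. cis (2 * pi * real i / real N)) {..<N}"
    using Complex.bij_betw_roots_unity[of N] assms(1) by (auto simp: bij_betw_def)
  then have ne: "\<omega> ^ k \<noteq> \<omega> ^ j" unfolding pw using assms False by (auto dest: inj_onD)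
  have w1: "cmod \<omega> = 1" unfolding \<omega>_def by simp
  then have w0: "\<omega> \<noteq> 0" and wc: "\<omega> * cnj \<omega> = 1" by (auto simp: complex_norm_square[symmetric])
  define S where "S = (\<Sum>\<mu>\<in>unity_roots N. \<mu> ^ k * cnj \<mu> ^ j)"
  have "S = (\<Sum>\<mu>\<in>unity_roots N. (\<omega> * \<mu>) ^ k * cnj (\<omega> * \<mu>) ^ j)"
    unfolding S_def
    by (rule sum.reindex_bij_witness[of _ "\<lambda>\<mu>. \<omega> * \<mu>" "\<lambda>\<mu>. \<mu> / \<omega>"])
      (use w0 wN in \<open>auto simp: unity_roots_def power_mult_distrib power_divide\<close>)
  also have "\<dots> = \<omega> ^ k * cnj \<omega> ^ j * S"
    unfolding S_def sum_distrib_left by (simp add: power_mult_distrib mult_ac)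
  finally have "S = \<omega> ^ k * cnj \<omega> ^ j * S" .
  from arg_cong[OF this, of "\<lambda>x. \<omega> ^ j * x"]
  have "\<omega> ^ j * S = \<omega> ^ k * (\<omega> * cnj \<omega>) ^ j * S"
    by (simp only: power_mult_distrib mult_ac)
  then have "\<omega> ^ j * S = \<omega> ^ k * S" using wc by simp
  then have "S = 0" using ne by simp
  then show ?thesis using False unfolding S_def by simp
qed

lemma DFT_inversion:
  assumes "N \<ge> 1" "s < N"
  shows "f s = of_real (1 / sqrt (real N)) * (\<Sum>\<mu>\<in>unity_roots N. DFT N f \<mu> * cnj \<mu> ^ s)"
proof -
  have "(\<Sum>\<mu>\<in>unity_roots N. DFT N f \<mu> * cnj \<mu> ^ s)
     = of_real (1 / sqrt (real N)) * (\<Sum>\<mu>\<in>unity_roots N. \<Sum>t<N. f t * (\<mu> ^ t * cnj \<mu> ^ s))"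
    by (simp add: DFT_def sum_distrib_left sum_distrib_right mult_ac)
  also have "(\<Sum>\<mu>\<in>unity_roots N. \<Sum>t<N. f t * (\<mu> ^ t * cnj \<mu> ^ s))
     = (\<Sum>t<N. f t * (\<Sum>\<mu>\<in>unity_roots N. \<mu> ^ t * cnj \<mu> ^ s))"
    by (subst sum.swap) (simp add: sum_distrib_left)
  also have "\<dots> = (\<Sum>t<N. f t * (if s = t then of_nat N else 0))"
    using assms by (intro sum.cong) (simp_all add: unity_roots_orthogonality)
  also have "\<dots> = f s * of_nat N" using assms(2) by (simp add: if_distrib cong: if_cong)
  finally have eq: "(\<Sum>\<mu>\<in>unity_roots N. DFT N f \<mu> * cnj \<mu> ^ s)
     = of_real (1 / sqrt (real N)) * (f s * of_nat N)" .
  have "1 / sqrt (real N) * (1 / sqrt (real N)) * real N = 1" using assms(1) by simp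
  then have "complex_of_real (1 / sqrt (real N)) * of_real (1 / sqrt (real N)) * of_nat N = 1"
    by (metis of_real_1 of_real_mult of_real_of_nat_eq)
  then show ?thesis unfolding eq by (metis (no_types) mult.assoc mult.commute mult_1)
qed

lemma Parseval_unity_roots:
  assumes "N \<ge> 1" "degree q < N"
  shows "(\<Sum>\<mu>\<in>unity_roots N. (cmod (poly q \<mu>))\<^sup>2) = real N * (wnorm 1 q)\<^sup>2"
proof -
  let ?D = "{..degree q}"
  have "complex_of_real (\<Sum>\<mu>\<in>unity_roots N. (cmod (poly q \<mu>))\<^sup>2)
     = (\<Sum>\<mu>\<in>unity_roots N. (\<Sum>i\<in>?D. coeff q i * \<mu> ^ i) * (\<Sum>j\<in>?D. cnj (coeff q j) * cnj \<mu> ^ j))"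
    by (simp only: of_real_sum complex_norm_square poly_altdef cnj_sum complex_cnj_mult complex_cnj_power)
  also have "\<dots> = (\<Sum>\<mu>\<in>unity_roots N. \<Sum>i\<in>?D. \<Sum>j\<in>?D. coeff q i * cnj (coeff q j) * (\<mu> ^ i * cnj \<mu> ^ j))"
    by (simp add: sum_product mult_ac)
  also have "\<dots> = (\<Sum>i\<in>?D. \<Sum>j\<in>?D. \<Sum>\<mu>\<in>unity_roots N. coeff q i * cnj (coeff q j) * (\<mu> ^ i * cnj \<mu> ^ j))"
    by (subst sum.swap, rule sum.cong[OF refl], subst sum.swap, rule refl)
  also have "\<dots> = (\<Sum>i\<in>?D. \<Sum>j\<in>?D. coeff q i * cnj (coeff q j) * (if j = i then of_nat N else 0))"
    using assms by (intro sum.cong refl) (simp add: sum_distrib_left[symmetric] unity_roots_orthogonality)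
  also have "\<dots> = (\<Sum>i\<in>?D. of_nat N * (coeff q i * cnj (coeff q i)))"
    by (intro sum.cong refl) (simp add: if_distrib mult.commute cong: if_cong)
  also have "\<dots> = complex_of_real (real N * (\<Sum>i\<in>?D. (cmod (coeff q i))\<^sup>2))"
    by (simp add: sum_distrib_left complex_norm_square[symmetric])
  also have "(\<Sum>i\<in>?D. (cmod (coeff q i))\<^sup>2) = (wnorm 1 q)\<^sup>2"
    by (simp add: wnorm_def L2_set_def sum_nonneg)
  finally show ?thesis by (simp only: of_real_eq_iff)
qed

section \<open>From the Fourier norm to the uniform norm\<close>

text \<open>By inversion, \<open>sqrt N * f t\<close> is the sum over the roots of unity of the Fourier transform of \<open>f\<close> times
  \<open>q\<^sup>2\<close> times unimodular factors. Squaring the filter turns the \<open>\<ell>\<^sub>1\<close> norm needed here into an \<open>\<ell>\<^sub>2\<close> norm, which Parseval computes.\<close>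

lemma squared_filter_bound:
  assumes "degree q \<le> M" "2 * M \<le> t" "t < N" "f (int t) = filt (q * q) f (int t)"
  shows "cmod (f (int t)) \<le> sqrt (real N) * (wnorm 1 q)\<^sup>2 * DFT_norm N (\<lambda>s. f (int s))"
proof -
  have N: "N \<ge> 1" using assms by simp
  let ?F = "DFT N (\<lambda>s. f (int s))" and ?B = "DFT_norm N (\<lambda>s. f (int s))"
  let ?r = "complex_of_real (1 / sqrt (real N))"
  define Q where "Q = q * q"
  have "degree Q \<le> degree q + degree q" unfolding Q_def by (rule degree_mult_le)
  then have dQ: "degree Q \<le> t" using assms by linarith
  have "filt Q f (int t) = (\<Sum>i\<le>degree Q. coeff Q i * (?r * (\<Sum>\<mu>\<in>unity_roots N. ?F \<mu> * cnj \<mu> ^ (t - i))))"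
    unfolding filt_def
  proof (intro sum.cong refl arg_cong2[where f = "(*)"])
    fix i assume "i \<in> {..degree Q}"
    then have i: "int t - int i = int (t - i)" "t - i < N" using dQ assms(3) by auto
    show "f (int t - int i) = ?r * (\<Sum>\<mu>\<in>unity_roots N. ?F \<mu> * cnj \<mu> ^ (t - i))"
      unfolding i(1) by (rule DFT_inversion[OF N i(2)])
  qed
  also have "\<dots> = ?r * (\<Sum>i\<le>degree Q. \<Sum>\<mu>\<in>unity_roots N. coeff Q i * (?F \<mu> * cnj \<mu> ^ (t - i)))"
    by (simp only: sum_distrib_left mult_ac)
  also have "\<dots> = ?r * (\<Sum>\<mu>\<in>unity_roots N. \<Sum>i\<le>degree Q. coeff Q i * (?F \<mu> * cnj \<mu> ^ (t - i)))"
    by (subst sum.swap) (rule refl)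
  also have "\<dots> = ?r * (\<Sum>\<mu>\<in>unity_roots N. ?F \<mu> * cnj \<mu> ^ t * (poly q \<mu>)\<^sup>2)"
  proof (intro sum.cong refl arg_cong2[where f = "(*)"])
    fix \<mu> assume "\<mu> \<in> unity_roots N"
    then have "cmod \<mu> = 1" using unity_roots_props(3)[OF N] by blast
    then have mu: "cnj \<mu> * \<mu> = 1" by (simp add: complex_norm_square[symmetric] mult.commute)
    have "cnj \<mu> ^ (t - i) = cnj \<mu> ^ t * \<mu> ^ i" if "i \<le> degree Q" for i
    proof -
      have "cnj \<mu> ^ t * \<mu> ^ i = cnj \<mu> ^ (t - i) * (cnj \<mu> * \<mu>) ^ i"
        using that dQ by (simp add: power_mult_distrib mult.assoc[symmetric] power_add[symmetric])
      then show ?thesis using mu by simp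
    qed
    then have "(\<Sum>i\<le>degree Q. coeff Q i * (?F \<mu> * cnj \<mu> ^ (t - i))) = (\<Sum>i\<le>degree Q. ?F \<mu> * cnj \<mu> ^ t * (coeff Q i * \<mu> ^ i))"
      by (intro sum.cong refl) (simp add: mult_ac)
    also have "\<dots> = ?F \<mu> * cnj \<mu> ^ t * poly Q \<mu>" by (simp add: poly_altdef sum_distrib_left)
    finally show "(\<Sum>i\<le>degree Q. coeff Q i * (?F \<mu> * cnj \<mu> ^ (t - i))) = ?F \<mu> * cnj \<mu> ^ t * (poly q \<mu>)\<^sup>2"
      by (simp add: Q_def power2_eq_square)
  qed
  finally have eq: "f (int t) = ?r * (\<Sum>\<mu>\<in>unity_roots N. ?F \<mu> * cnj \<mu> ^ t * (poly q \<mu>)\<^sup>2)"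
    using assms(4) unfolding Q_def by simp
  have "cmod (\<Sum>\<mu>\<in>unity_roots N. ?F \<mu> * cnj \<mu> ^ t * (poly q \<mu>)\<^sup>2) \<le> (\<Sum>\<mu>\<in>unity_roots N. ?B * (cmod (poly q \<mu>))\<^sup>2)"
  proof (rule sum_norm_le)
    fix \<mu> assume mu: "\<mu> \<in> unity_roots N"
    then show "cmod (?F \<mu> * cnj \<mu> ^ t * (poly q \<mu>)\<^sup>2) \<le> ?B * (cmod (poly q \<mu>))\<^sup>2"
      using DFT_le_DFT_norm[OF N mu, of "\<lambda>s. f (int s)"] unity_roots_props(3)[OF N mu]
      by (simp add: norm_mult norm_power mult_right_mono)
  qed
  also have "\<dots> = ?B * (real N * (wnorm 1 q)\<^sup>2)"
    using assms by (subst Parseval_unity_roots[symmetric]) (auto simp: sum_distrib_left)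
  finally have "cmod (f (int t)) \<le> 1 / sqrt (real N) * (?B * (real N * (wnorm 1 q)\<^sup>2))"
    unfolding eq norm_mult by (intro mult_mono) (auto simp: norm_divide)
  also have "\<dots> = real N / sqrt (real N) * (wnorm 1 q)\<^sup>2 * ?B" by simp
  also have "real N / sqrt (real N) = sqrt (real N)" by (simp add: real_div_sqrt)
  finally show ?thesis .
qed

lemma trivial_sup_bound:
  assumes "t < N"
  shows "cmod (f t) \<le> sqrt (real N) * DFT_norm N f"
proof -
  have N: "N \<ge> 1" using assms by simp
  have "cmod (\<Sum>\<mu>\<in>unity_roots N. DFT N f \<mu> * cnj \<mu> ^ t) \<le> (\<Sum>\<mu>\<in>unity_roots N. DFT_norm N f)"
    by (rule sum_norm_le)
      (simp add: norm_mult norm_power unity_roots_props(3)[OF N] DFT_le_DFT_norm[OF N])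
  also have "\<dots> = real N * DFT_norm N f" using unity_roots_props(4)[OF N] by simp
  finally have "cmod (f t) \<le> 1 / sqrt (real N) * (real N * DFT_norm N f)"
    unfolding DFT_inversion[OF N assms, of f] norm_mult by (intro mult_mono) (auto simp: norm_divide)
  also have "\<dots> = real N / sqrt (real N) * DFT_norm N f" by simp
  also have "real N / sqrt (real N) = sqrt (real N)" by (simp add: real_div_sqrt)
  finally show ?thesis .
qed

lemma zero_notin_unimodular: "\<forall>\<zeta>\<in>#\<Lambda>. cmod \<zeta> = 1 \<Longrightarrow> 0 \<notin># \<Lambda>"
  by auto

text \<open>At times \<open>t \<ge> (N - 1) / 2\<close> there is room to the left for a reproducing filter \<open>q\<close> whose square has degree about \<open>N / 2\<close>.
  It exists once \<open>N\<close> is of order at least \<open>d ^ 3\<close>; for smaller \<open>N\<close> the trivial bound \<open>sqrt N\<close> is already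
  of the required order \<open>d ^ 3 / sqrt N\<close>.\<close>

lemma second_half_bound:
  assumes "\<forall>\<zeta>\<in>#\<Lambda>. cmod \<zeta> = 1" "size \<Lambda> = d" "d \<ge> 1"
    "\<And>s. int d \<le> s \<Longrightarrow> s < int N \<Longrightarrow> filt (root_poly \<Lambda>) f s = 0"
    "t < N" "N - 1 \<le> 2 * t"
  shows "cmod (f (int t)) \<le> 576 * real d ^ 3 / sqrt (real N) * DFT_norm N (\<lambda>s. f (int s))"
proof -
  let ?B = "DFT_norm N (\<lambda>s. f (int s))"
  have N: "N \<ge> 1" using assms by simp
  have B: "?B \<ge> 0" using N by (rule DFT_norm_nonneg)
  have sq: "sqrt (real N) = real N / sqrt (real N)" by (simp add: real_div_sqrt)
  have "\<exists>c\<ge>0. cmod (f (int t)) \<le> sqrt (real N) * c * ?B \<and> c * real N \<le> 576 * real d ^ 3"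
  proof (cases "d * (2 * d + 1) \<le> (N - 1) div (8 * d)")
    case True
    \<comment> \<open>The squared filter has degree at most \<open>4 * d * L \<le> (N - 1) / 2 \<le> t\<close>.\<close>
    define L where "L = (N - 1) div (8 * d)"
    have "1 * 1 \<le> d * (2 * d + 1)" using assms(3) by (intro mult_le_mono) auto
    then have L1: "L \<ge> 1" using True L_def by simp
    have "N - 1 < 8 * d * (L + 1)"
      using dividend_less_times_div[of "8 * d" "N - 1"] assms(3) by (simp add: L_def algebra_simps)
    moreover have "8 * d * (L + 1) = 8 * (d * L) + 8 * d" by (simp add: algebra_simps)
    moreover have "d \<le> d * L" using L1 by simp
    ultimately have NL: "N \<le> 16 * (d * L)" by linarith
    have LN: "8 * (d * L) \<le> N - 1"
      using div_times_less_eq_dividend[of "N - 1" "8 * d"] by (simp add: L_def mult_ac)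
    obtain q where q: "root_poly \<Lambda> dvd 1 - q" "coeff q 0 = 0" "degree q \<le> 2 * d * L"
        "(wnorm 1 q)\<^sup>2 \<le> 36 * real d ^ 2 / real L"
      using exists_reproducing_filter[OF assms(1-3)] True L_def by blast
    have "1 - q * q = (1 - q) * (1 + q)" by (simp add: algebra_simps)
    then have dvd: "root_poly \<Lambda> dvd 1 - q * q" using q(1) by (metis dvd_mult2)
    have "coeff (1 - q * q) 0 = 1" using q(2) by (simp add: coeff_mult_0)
    then have nz: "1 - q * q \<noteq> 0" by (metis coeff_0 zero_neq_one)
    have tL: "2 * (2 * d * L) \<le> t" using LN assms(6) by simp
    have "degree (q * q) \<le> degree q + degree q" by (rule degree_mult_le)
    then have "degree (1 - q * q) \<le> t" using q(3) tL by (intro degree_diff_le) auto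
    moreover have "degree (root_poly \<Lambda>) = d"
      using degree_root_poly[OF zero_notin_unimodular[OF assms(1)]] assms(2) by simp
    ultimately have "filt (1 - q * q) f (int t) = 0"
      using assms(4,5) by (intro filt_multiple_eq_0[OF dvd nz, of "int d"]) auto
    moreover have "filt 1 f (int t) = filt (1 - q * q) f (int t) + filt (q * q) f (int t)"
      by (simp add: filt_add[symmetric] del: filt_1)
    ultimately have "f (int t) = filt (q * q) f (int t)" by simp
    then have "cmod (f (int t)) \<le> sqrt (real N) * (wnorm 1 q)\<^sup>2 * ?B"
      using squared_filter_bound[OF q(3) tL assms(5)] by blast
    moreover have "(wnorm 1 q)\<^sup>2 * real N \<le> 576 * real d ^ 3"
    proof -
      have "(wnorm 1 q)\<^sup>2 * real N \<le> 36 * real d ^ 2 / real L * (16 * (real d * real L))"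
        using q(4) NL by (intro mult_mono) (auto simp flip: of_nat_mult)
      also have "\<dots> = 576 * real d ^ 3" using L1 by (simp add: power2_eq_square power3_eq_cube)
      finally show ?thesis .
    qed
    ultimately show ?thesis by (intro exI[of _ "(wnorm 1 q)\<^sup>2"]) auto
  next
    case False
    then have "(N - 1) div (8 * d) < d * (2 * d + 1)" by simp
    then have "N - 1 < d * (2 * d + 1) * (8 * d)"
      using assms(3) by (simp add: div_less_iff_less_mult)
    then have "N \<le> d * (2 * d + 1) * (8 * d)" by simp
    also have "\<dots> \<le> d * (2 * d + d) * (8 * d)" using assms(3) by (intro mult_le_mono) auto
    also have "\<dots> = 24 * d ^ 3" by (simp add: power3_eq_cube)
    finally have "real N \<le> real (24 * d ^ 3)" by (simp only: of_nat_le_iff)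
    then have "1 * real N \<le> 576 * real d ^ 3" by simp
    moreover have "cmod (f (int t)) \<le> sqrt (real N) * 1 * ?B"
      using trivial_sup_bound[OF assms(5), of "\<lambda>s. f (int s)"] by simp
    ultimately show ?thesis by (intro exI[of _ 1]) simp
  qed
  then obtain c where c: "c \<ge> 0" "cmod (f (int t)) \<le> sqrt (real N) * c * ?B" "c * real N \<le> 576 * real d ^ 3"
    by blast
  have "sqrt (real N) * c = (c * real N) / sqrt (real N)" by (subst sq) simp
  also have "\<dots> \<le> 576 * real d ^ 3 / sqrt (real N)" by (intro divide_right_mono c) simp
  finally show ?thesis using c(2) B by (meson mult_right_mono order_trans)
qed

lemma DFT_norm_reversal_le:
  assumes "N \<ge> 1"
  shows "DFT_norm N (\<lambda>s. f (N - 1 - s)) \<le> DFT_norm N f"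
proof (rule DFT_norm_le[OF assms])
  fix \<mu> assume mu: "\<mu> \<in> unity_roots N"
  then have m1: "cmod \<mu> = 1" using unity_roots_props(3)[OF assms] by blast
  then have mc: "\<mu> * cnj \<mu> = 1" by (simp add: complex_norm_square[symmetric])
  have "(\<Sum>s<N. f (N - 1 - s) * \<mu> ^ s) = (\<Sum>s<N. f s * \<mu> ^ (N - 1 - s))"
    by (rule sum.reindex_bij_witness[of _ "\<lambda>s. N - 1 - s" "\<lambda>s. N - 1 - s"]) auto
  also have "\<dots> = (\<Sum>s<N. \<mu> ^ (N - 1) * (f s * cnj \<mu> ^ s))"
  proof (intro sum.cong refl)
    fix s assume "s \<in> {..<N}"
    then have "\<mu> ^ (N - 1) * cnj \<mu> ^ s = \<mu> ^ (N - 1 - s) * (\<mu> * cnj \<mu>) ^ s"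
      by (simp add: power_mult_distrib mult.assoc[symmetric] power_add[symmetric])
    then show "f s * \<mu> ^ (N - 1 - s) = \<mu> ^ (N - 1) * (f s * cnj \<mu> ^ s)" using mc by (simp add: mult_ac)
  qed
  finally have "DFT N (\<lambda>s. f (N - 1 - s)) \<mu> = \<mu> ^ (N - 1) * DFT N f (cnj \<mu>)"
    by (simp add: DFT_def sum_distrib_left mult_ac)
  moreover have "cnj \<mu> \<in> unity_roots N"
    using mu by (auto simp: unity_roots_def simp flip: complex_cnj_power)
  ultimately show "cmod (DFT N (\<lambda>s. f (N - 1 - s)) \<mu>) \<le> DFT_norm N f"
    using DFT_le_DFT_norm[OF assms, of "cnj \<mu>" f] m1 by (simp add: norm_mult norm_power)
qed

lemma exact_signal_bound:
  assumes "\<forall>\<zeta>\<in>#\<Lambda>. cmod \<zeta> = 1" "size \<Lambda> = d" "d \<ge> 1"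
    "\<And>s. int d \<le> s \<Longrightarrow> s < int N \<Longrightarrow> filt (root_poly \<Lambda>) f s = 0" "t < N"
  shows "cmod (f (int t)) \<le> 576 * real d ^ 3 / sqrt (real N) * DFT_norm N (\<lambda>s. f (int s))"
proof (cases "N - 1 \<le> 2 * t")
  case True
  then show ?thesis using assms by (intro second_half_bound[of \<Lambda>]) auto
next
  case False
  have N: "N \<ge> 1" using assms by simp
  define g where "g s = f (int (N - 1) - s)" for s
  let ?\<Lambda> = "image_mset cnj \<Lambda>"
  obtain c where c: "c \<noteq> 0" "reflect_poly (root_poly \<Lambda>) = smult c (root_poly ?\<Lambda>)"
    using reflect_root_poly[OF assms(1)] by blast
  have dp: "degree (root_poly \<Lambda>) = d"
    using degree_root_poly[OF zero_notin_unimodular[OF assms(1)]] assms(2) by simp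
  have unit: "\<forall>\<zeta>\<in>#?\<Lambda>. cmod \<zeta> = 1" using assms(1) by auto
  have p0: "coeff (root_poly \<Lambda>) 0 \<noteq> 0" by (simp add: coeff_root_poly_0)
  have rec: "filt (root_poly ?\<Lambda>) g s = 0" if "int d \<le> s" "s < int N" for s
  proof -
    have "f = (\<lambda>s. g (int (N - 1) - s))" by (simp add: g_def)
    then have "filt (root_poly \<Lambda>) f (int (N - 1) - s + int d)
       = filt (reflect_poly (root_poly \<Lambda>)) g (int (N - 1) - (int (N - 1) - s + int d) + int d)"
      using filt_reversal[OF p0, of g "int (N - 1)" "int (N - 1) - s + int d"] dp by simp
    moreover have "filt (root_poly \<Lambda>) f (int (N - 1) - s + int d) = 0"
      using that N by (intro assms(4)) auto
    ultimately have "c * filt (root_poly ?\<Lambda>) g s = 0" unfolding c(2) filt_smult by simp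
    then show ?thesis using c(1) by simp
  qed
  have "cmod (g (int (N - 1 - t))) \<le> 576 * real d ^ 3 / sqrt (real N) * DFT_norm N (\<lambda>s. g (int s))"
    using False assms(2,3,5) rec by (intro second_half_bound[OF unit]) auto
  also have "DFT_norm N (\<lambda>s. g (int s)) = DFT_norm N (\<lambda>s. f (int (N - 1 - s)))"
    by (rule DFT_norm_cong) (simp add: g_def of_nat_diff diff_diff_eq)
  also have "g (int (N - 1 - t)) = f (int t)" using assms(5) by (simp add: g_def of_nat_diff)
  also have "576 * real d ^ 3 / sqrt (real N) * DFT_norm N (\<lambda>s. f (int (N - 1 - s)))
     \<le> 576 * real d ^ 3 / sqrt (real N) * DFT_norm N (\<lambda>s. f (int s))"
    using DFT_norm_reversal_le[OF N, of "\<lambda>s. f (int s)"] by (intro mult_left_mono) auto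
  finally show ?thesis .
qed

lemma approximate_signal_correction:
  assumes "\<forall>\<zeta>\<in>#\<Lambda>. cmod \<zeta> = 1" "\<And>t. t < N \<Longrightarrow> cmod (filt (root_poly \<Lambda>) a (int t)) \<le> \<delta>" "\<delta> \<ge> 0"
  shows "\<exists>v. (\<forall>t. 0 \<le> t \<longrightarrow> t < int N \<longrightarrow> filt (root_poly \<Lambda>) (\<lambda>t. a t - v t) t = 0)
     \<and> (\<forall>t<N. cmod (v (int t)) \<le> real N ^ size \<Lambda> * \<delta>)"
proof -
  define e where "e t = (if 0 \<le> t \<and> t < int N then filt (root_poly \<Lambda>) a t else 0)" for t
  have "cmod (e t) \<le> \<delta>" if "0 \<le> t" "t < int N" for t
    using assms(2)[of "nat t"] that by (simp add: e_def nat_less_iff)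
  then obtain v where v: "\<forall>t. filt (root_poly \<Lambda>) v t = e t"
      "\<forall>t\<ge>0. t < int N \<longrightarrow> cmod (v t) \<le> real N ^ size \<Lambda> * \<delta>"
    using exists_filter_preimage[OF assms(1), of N e \<delta>] assms(3) by (auto simp: e_def)
  then show ?thesis by (intro exI[of _ v]) (auto simp: filt_diff_right e_def)
qed

text \<open>Subtracting corrections from \<open>a\<close> and \<open>b\<close> makes them exact solutions on the block. Their sum is then annihilated
  by the product of both root polynomials at all times from \<open>d\<close> on, and the previous estimate applies. The corrections
  have size at most \<open>\<eta>\<close>, hence Fourier norm at most \<open>sqrt N * \<eta>\<close>.\<close>

lemma approximate_sum_bound:
  fixes a b :: "int \<Rightarrow> complex"
  assumes "\<forall>\<zeta>\<in>#\<Lambda>1. cmod \<zeta> = 1" "\<forall>\<zeta>\<in>#\<Lambda>2. cmod \<zeta> = 1" "d = size \<Lambda>1 + size \<Lambda>2" "d \<ge> 1"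
    and "\<And>t. t < N \<Longrightarrow> cmod (filt (root_poly \<Lambda>1) a (int t)) \<le> \<delta>1" "\<delta>1 \<ge> 0"
    and "\<And>t. t < N \<Longrightarrow> cmod (filt (root_poly \<Lambda>2) b (int t)) \<le> \<delta>2" "\<delta>2 \<ge> 0"
    and "t < N"
  defines "\<eta> \<equiv> real N ^ size \<Lambda>1 * \<delta>1 + real N ^ size \<Lambda>2 * \<delta>2"
  shows "cmod (a (int t) + b (int t))
    \<le> 576 * real d ^ 3 / sqrt (real N) * (DFT_norm N (\<lambda>s. a (int s) + b (int s)) + sqrt (real N) * \<eta>) + \<eta>"
proof -
  have N: "N \<ge> 1" using assms by simp
  obtain v1 where v1: "\<And>t. 0 \<le> t \<Longrightarrow> t < int N \<Longrightarrow> filt (root_poly \<Lambda>1) (\<lambda>t. a t - v1 t) t = 0"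
      "\<And>t. t < N \<Longrightarrow> cmod (v1 (int t)) \<le> real N ^ size \<Lambda>1 * \<delta>1"
    using approximate_signal_correction[OF assms(1,5,6)] by blast
  obtain v2 where v2: "\<And>t. 0 \<le> t \<Longrightarrow> t < int N \<Longrightarrow> filt (root_poly \<Lambda>2) (\<lambda>t. b t - v2 t) t = 0"
      "\<And>t. t < N \<Longrightarrow> cmod (v2 (int t)) \<le> real N ^ size \<Lambda>2 * \<delta>2"
    using approximate_signal_correction[OF assms(2,7,8)] by blast
  define g where "g t = (a t - v1 t) + (b t - v2 t)" for t
  let ?P = "root_poly (\<Lambda>1 + \<Lambda>2)"
  have P: "?P = root_poly \<Lambda>1 * root_poly \<Lambda>2" by (simp add: root_poly_def)
  have unit: "\<forall>\<zeta>\<in>#\<Lambda>1 + \<Lambda>2. cmod \<zeta> = 1" using assms(1,2) by auto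
  have "degree ?P \<le> d" using degree_root_poly_le[of "\<Lambda>1 + \<Lambda>2"] assms(3) by simp
  then have "filt ?P g s = 0" if "int d \<le> s" "s < int N" for s
  proof -
    have "filt ?P (\<lambda>t. a t - v1 t) s = 0"
    proof (rule filt_multiple_eq_0[of "root_poly \<Lambda>1" _ 0])
      show "filt (root_poly \<Lambda>1) (\<lambda>t. a t - v1 t) r = 0" if "0 \<le> r" "r \<le> s" for r
        using that \<open>s < int N\<close> by (intro v1(1)) auto
    qed (use \<open>degree ?P \<le> d\<close> that in \<open>auto simp: P root_poly_nz\<close>)
    moreover have "filt ?P (\<lambda>t. b t - v2 t) s = 0"
    proof (rule filt_multiple_eq_0[of "root_poly \<Lambda>2" _ 0])
      show "filt (root_poly \<Lambda>2) (\<lambda>t. b t - v2 t) r = 0" if "0 \<le> r" "r \<le> s" for r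
        using that \<open>s < int N\<close> by (intro v2(1)) auto
    qed (use \<open>degree ?P \<le> d\<close> that in \<open>auto simp: P root_poly_nz\<close>)
    ultimately show ?thesis unfolding g_def filt_add_right by simp
  qed
  then have g: "cmod (g (int t)) \<le> 576 * real d ^ 3 / sqrt (real N) * DFT_norm N (\<lambda>s. g (int s))"
    using assms(3,4,9) by (intro exact_signal_bound[OF unit]) auto
  have vb: "cmod (v1 (int s) + v2 (int s)) \<le> \<eta>" if "s < N" for s
    unfolding \<eta>_def by (rule norm_triangle_mono[OF v1(2)[OF that] v2(2)[OF that]])
  have "DFT_norm N (\<lambda>s. g (int s)) = DFT_norm N (\<lambda>s. (a (int s) + b (int s)) + - (v1 (int s) + v2 (int s)))"
    by (simp add: g_def algebra_simps)
  also have "\<dots> \<le> DFT_norm N (\<lambda>s. a (int s) + b (int s)) + DFT_norm N (\<lambda>s. v1 (int s) + v2 (int s))"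
    using DFT_norm_triangle[OF N, of "\<lambda>s. a (int s) + b (int s)" "\<lambda>s. - (v1 (int s) + v2 (int s))"]
    unfolding DFT_norm_uminus .
  also have "DFT_norm N (\<lambda>s. v1 (int s) + v2 (int s)) \<le> sqrt (real N) * \<eta>"
    using vb by (intro DFT_norm_le_sup[OF N]) auto
  finally have "576 * real d ^ 3 / sqrt (real N) * DFT_norm N (\<lambda>s. g (int s))
     \<le> 576 * real d ^ 3 / sqrt (real N) * (DFT_norm N (\<lambda>s. a (int s) + b (int s)) + sqrt (real N) * \<eta>)"
    by (intro mult_left_mono) auto
  moreover have "a (int t) + b (int t) = g (int t) + (v1 (int t) + v2 (int t))" by (simp add: g_def)
  then have "cmod (a (int t) + b (int t)) \<le> cmod (g (int t)) + \<eta>"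
    using norm_triangle_ineq[of "g (int t)" "v1 (int t) + v2 (int t)"] vb[OF assms(9)] by simp
  ultimately show ?thesis using g by linarith
qed

section \<open>Gaussian noise\<close>

lemma std_gauss_PiM: "std_gauss N = Pi\<^sub>M {..<N} (\<lambda>_. std_normal_distribution)"
  unfolding std_gauss_def by simp

lemma prob_space_std_gauss: "prob_space (std_gauss N)"
  unfolding std_gauss_PiM by (intro prob_space_PiM prob_space_normal_density) simp

lemma sets_std_gauss: "sets (std_gauss N) = sets (vec_space N)"
  unfolding std_gauss_def vec_space_def by (intro sets_PiM_cong) auto

lemma space_std_gauss: "space (std_gauss N) = space (vec_space N)"
  using sets_std_gauss by (rule sets_eq_imp_space_eq)

text \<open>Completing the square: \<open>exp (c * u)\<close> times the standard density is \<open>exp (c\<^sup>2 / 2)\<close> times the density with mean \<open>c\<close>.\<close>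

lemma normal_exp_moment:
  "(\<integral>\<^sup>+u. ennreal (exp (c * u)) \<partial>density lborel (\<lambda>u. ennreal (std_normal_density u))) = ennreal (exp (c\<^sup>2 / 2))"
proof -
  have "(\<integral>\<^sup>+u. ennreal (exp (c * u)) \<partial>density lborel (\<lambda>u. ennreal (std_normal_density u)))
     = (\<integral>\<^sup>+u. ennreal (std_normal_density u) * ennreal (exp (c * u)) \<partial>lborel)"
    by (rule nn_integral_density) auto
  also have "\<dots> = (\<integral>\<^sup>+u. ennreal (exp (c\<^sup>2 / 2)) * ennreal (normal_density c 1 u) \<partial>lborel)"
  proof (rule nn_integral_cong)
    fix u :: real
    have "std_normal_density u * exp (c * u) = exp (c\<^sup>2 / 2) * normal_density c 1 u"
      unfolding normal_density_def by (simp add: exp_add[symmetric] power2_eq_square field_simps)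
    then show "ennreal (std_normal_density u) * ennreal (exp (c * u)) = ennreal (exp (c\<^sup>2 / 2)) * ennreal (normal_density c 1 u)"
      by (simp add: ennreal_mult[symmetric])
  qed
  also have "\<dots> = ennreal (exp (c\<^sup>2 / 2)) * (\<integral>\<^sup>+u. ennreal (normal_density c 1 u) \<partial>lborel)"
    by (rule nn_integral_cmult) auto
  also have "(\<integral>\<^sup>+u. ennreal (normal_density c 1 u) \<partial>lborel) = 1"
    using prob_space.emeasure_space_1[OF prob_space_normal_density[of 1 c]]
    by (simp add: emeasure_density)
  finally show ?thesis by simp
qed

text \<open>Chernoff bound with the optimal exponent \<open>s\<close>.\<close>

lemma gauss_linear_tail:
  assumes "(\<Sum>t<N. (a t)\<^sup>2) \<le> 1" "s > 0"
  shows "emeasure (std_gauss N) {\<xi> \<in> space (std_gauss N). (\<Sum>t<N. a t * \<xi> t) \<ge> s} \<le> ennreal (exp (- s\<^sup>2 / 2))"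
proof -
  let ?M = "std_gauss N" and ?D = "density lborel (\<lambda>u. ennreal (std_normal_density u))"
  interpret D: prob_space ?D using prob_space_normal_density[of 1 0] by simp
  interpret P: product_sigma_finite "\<lambda>_::nat. ?D"
    by (simp add: product_sigma_finite_def D.sigma_finite_measure_axioms)
  let ?f = "\<lambda>\<xi>. ennreal (exp (s * (\<Sum>t<N. a t * \<xi> t)))"
  have meas: "?f \<in> borel_measurable ?M"
    unfolding std_gauss_def by measurable
  have "(\<integral>\<^sup>+\<xi>. ?f \<xi> \<partial>?M) = (\<integral>\<^sup>+\<xi>. (\<Prod>t\<in>{..<N}. ennreal (exp (s * a t * \<xi> t))) \<partial>Pi\<^sub>M {..<N} (\<lambda>_. ?D))"
    unfolding std_gauss_def
    by (intro nn_integral_cong) (simp add: prod_ennreal exp_sum[symmetric] sum_distrib_left mult.assoc)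
  also have "\<dots> = (\<Prod>t\<in>{..<N}. \<integral>\<^sup>+u. ennreal (exp (s * a t * u)) \<partial>?D)"
    by (rule P.product_nn_integral_prod) auto
  also have "\<dots> = (\<Prod>t\<in>{..<N}. ennreal (exp ((s * a t)\<^sup>2 / 2)))"
    by (simp only: normal_exp_moment)
  also have "\<dots> = ennreal (exp (s\<^sup>2 / 2 * (\<Sum>t<N. (a t)\<^sup>2)))"
    by (simp add: prod_ennreal exp_sum[symmetric] sum_distrib_left power_mult_distrib)
  also have "\<dots> \<le> ennreal (exp (s\<^sup>2 / 2))"
    using assms(1) mult_left_mono[OF assms(1), of "s\<^sup>2 / 2"] by (intro ennreal_leI) simp
  finally have int: "(\<integral>\<^sup>+\<xi>. ?f \<xi> \<partial>?M) \<le> ennreal (exp (s\<^sup>2 / 2))" .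
  let ?A = "{\<xi> \<in> space ?M. (\<Sum>t<N. a t * \<xi> t) \<ge> s}"
  have A: "?A \<in> sets ?M" unfolding std_gauss_def by measurable
  have "ennreal (exp (s\<^sup>2)) * emeasure ?M ?A = (\<integral>\<^sup>+\<xi>. ennreal (exp (s\<^sup>2)) * indicator ?A \<xi> \<partial>?M)"
    using A by (simp add: nn_integral_cmult_indicator)
  also have "\<dots> \<le> (\<integral>\<^sup>+\<xi>. ?f \<xi> \<partial>?M)"
    using assms(2) by (intro nn_integral_mono) (auto simp: indicator_def power2_eq_square intro!: ennreal_leI)
  also note int
  finally have *: "ennreal (exp (s\<^sup>2)) * emeasure ?M ?A \<le> ennreal (exp (s\<^sup>2 / 2))" .
  have "emeasure ?M ?A = ennreal (exp (- s\<^sup>2)) * (ennreal (exp (s\<^sup>2)) * emeasure ?M ?A)"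
    by (simp add: mult.assoc[symmetric] ennreal_mult[symmetric] exp_add[symmetric])
  also have "\<dots> \<le> ennreal (exp (- s\<^sup>2)) * ennreal (exp (s\<^sup>2 / 2))"
    using * by (rule mult_left_mono) simp
  also have "\<dots> = ennreal (exp (- s\<^sup>2 / 2))"
    by (simp add: ennreal_mult[symmetric] exp_add[symmetric])
  finally show ?thesis .
qed

section \<open>The quantile of the Fourier norm of the noise\<close>

lemma DFT_norm_measurable:
  assumes "N \<ge> 1"
  shows "(\<lambda>\<xi>. DFT_norm N (\<lambda>t. complex_of_real (\<xi> t))) \<in> borel_measurable (vec_space N)"
proof -
  have comp: "(\<lambda>\<xi>. \<xi> t) \<in> borel_measurable (vec_space N)" if "t < N" for t
    unfolding vec_space_def using that by (intro measurable_component_singleton) auto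
  have "(\<lambda>\<xi>. DFT N (\<lambda>t. complex_of_real (\<xi> t)) \<mu>) \<in> borel_measurable (vec_space N)" for \<mu>
    unfolding DFT_def using comp
    by (intro borel_measurable_times borel_measurable_sum borel_measurable_const borel_measurable_of_real) auto
  then show ?thesis
    unfolding DFT_norm_def using unity_roots_props(1)[OF assms]
    by (intro borel_measurable_Max borel_measurable_norm) auto
qed

text \<open>The infimum defining the quantile is attained because distribution functions are right-continuous.\<close>

lemma gauss_DFT_quantile_attained:
  assumes "N \<ge> 1" "0 < \<alpha>" "\<alpha> < 1"
  shows "measure (std_gauss N) {\<xi> \<in> space (std_gauss N). DFT_norm N (\<lambda>t. complex_of_real (\<xi> t)) \<le> qN N \<alpha>} \<ge> 1 - \<alpha>"
proof -
  let ?M = "std_gauss N" and ?X = "\<lambda>\<xi>. DFT_norm N (\<lambda>t. complex_of_real (\<xi> t))"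
  interpret prob_space ?M by (rule prob_space_std_gauss)
  have X: "?X \<in> borel_measurable ?M"
    using DFT_norm_measurable[OF assms(1)] by (simp cong: measurable_cong_sets add: sets_std_gauss)
  define D where "D = distr ?M borel ?X"
  interpret D: real_distribution D unfolding D_def using X by (rule real_distribution_distr)
  have cdf: "measure ?M {\<xi> \<in> space ?M. ?X \<xi> \<le> q} = cdf D q" for q
    unfolding cdf_def D_def using X by (subst measure_distr) (auto simp: vimage_def Int_def conj_commute)
  define S where "S = {q. cdf D q \<ge> 1 - \<alpha>}"
  have q: "qN N \<alpha> = Inf S" unfolding qN_def cdf S_def by simp
  have "eventually (\<lambda>q. cdf D q > 1 - \<alpha>) at_top"
    using D.cdf_lim_at_top_prob assms(2) by (intro order_tendstoD) auto
  then obtain q0 where "cdf D q0 > 1 - \<alpha>"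
    by (metis eventually_happens trivial_limit_at_top_linorder)
  then have "q0 \<in> S" unfolding S_def by simp
  then have ne: "S \<noteq> {}" by blast
  have bdd: "bdd_below S"
  proof (rule bdd_belowI)
    fix x assume x: "x \<in> S"
    show "0 \<le> x"
    proof (rule ccontr)
      assume "\<not> 0 \<le> x"
      then have "\<not> ?X \<xi> \<le> x" for \<xi>
        using DFT_norm_nonneg[OF assms(1), of "\<lambda>t. complex_of_real (\<xi> t)"] by linarith
      then have "{\<xi> \<in> space ?M. ?X \<xi> \<le> x} = {}" by simp
      then have "cdf D x = 0" unfolding cdf[symmetric] by (simp only: measure_empty)
      then show False using x assms(3) unfolding S_def by simp
    qed
  qed
  have "cdf D (Inf S) \<ge> 1 - \<alpha>"
  proof (rule ccontr)
    assume "\<not> cdf D (Inf S) \<ge> 1 - \<alpha>"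
    moreover have "(cdf D \<longlongrightarrow> cdf D (Inf S)) (at_right (Inf S))"
      using D.cdf_is_right_cont[of "Inf S"] by (simp add: continuous_within)
    ultimately have "eventually (\<lambda>q. cdf D q < 1 - \<alpha>) (at_right (Inf S))"
      by (intro order_tendstoD) auto
    then obtain b where b: "b > Inf S" "\<And>q. Inf S < q \<Longrightarrow> q < b \<Longrightarrow> cdf D q < 1 - \<alpha>"
      unfolding eventually_at_right_field by blast
    then obtain s where s: "s \<in> S" "s < b" using cInf_lessD[OF ne] by blast
    then have "Inf S \<le> s" using bdd by (intro cInf_lower)
    then show False
      using s b(2)[of s] \<open>\<not> cdf D (Inf S) \<ge> 1 - \<alpha>\<close> by (cases "s = Inf S") (auto simp: S_def)
  qed
  then show ?thesis unfolding cdf q .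
qed

lemma gauss_DFT_exceeds_quantile:
  assumes "N \<ge> 1" "0 < \<alpha>" "\<alpha> < 1"
  shows "emeasure (std_gauss N) {\<xi> \<in> space (std_gauss N). DFT_norm N (\<lambda>t. complex_of_real (\<xi> t)) > qN N \<alpha>} \<le> ennreal \<alpha>"
proof -
  let ?M = "std_gauss N" and ?X = "\<lambda>\<xi>. DFT_norm N (\<lambda>t. complex_of_real (\<xi> t))"
  interpret prob_space ?M by (rule prob_space_std_gauss)
  have X: "?X \<in> borel_measurable ?M"
    using DFT_norm_measurable[OF assms(1)] by (simp cong: measurable_cong_sets add: sets_std_gauss)
  then have "{\<xi> \<in> space ?M. ?X \<xi> \<le> qN N \<alpha>} \<in> events" by measurable
  from prob_compl[OF this]
  have "prob (space ?M - {\<xi> \<in> space ?M. ?X \<xi> \<le> qN N \<alpha>}) \<le> \<alpha>"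
    using gauss_DFT_quantile_attained[OF assms] by simp
  also have "space ?M - {\<xi> \<in> space ?M. ?X \<xi> \<le> qN N \<alpha>} = {\<xi> \<in> space ?M. ?X \<xi> > qN N \<alpha>}" by auto
  finally show ?thesis unfolding emeasure_eq_measure by (rule ennreal_leI)
qed

text \<open>A Fourier coefficient of modulus above \<open>q\<close> has real or imaginary part of modulus at least \<open>q / 2\<close>. This yields
  \<open>4 * N\<close> one-sided events for linear forms of unit variance at most, each of probability at most \<open>exp (- q\<^sup>2 / 8)\<close>;
  the value of \<open>q\<close> makes the union bound equal to \<open>\<alpha>\<close>.\<close>

lemma qN_upper_bound:
  assumes "N \<ge> 1" "0 < \<alpha>" "\<alpha> < 1 / 2"
  shows "qN N \<alpha> \<le> 5 * sqrt (ln (real N / \<alpha>))"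
proof -
  let ?M = "std_gauss N" and ?X = "\<lambda>\<xi>. DFT_norm N (\<lambda>t. complex_of_real (\<xi> t))"
  interpret prob_space ?M by (rule prob_space_std_gauss)
  have X: "?X \<in> borel_measurable ?M"
    using DFT_norm_measurable[OF assms(1)] by (simp cong: measurable_cong_sets add: sets_std_gauss)
  define q where "q = sqrt (8 * ln (4 * real N / \<alpha>))"
  have Na: "real N / \<alpha> \<ge> 2"
  proof -
    have "1 / (1 / 2) \<le> real N / \<alpha>" using assms by (intro frac_le) auto
    then show ?thesis by simp
  qed
  have "4 * real N / \<alpha> > 1" using Na by simp
  then have lnpos: "ln (4 * real N / \<alpha>) > 0" using ln_gt_zero by blast
  then have q0: "q > 0" unfolding q_def by simp
  have q2: "q\<^sup>2 = 8 * ln (4 * real N / \<alpha>)" unfolding q_def using lnpos by simp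
  have ex: "exp (- (q / 2)\<^sup>2 / 2) = \<alpha> / (4 * real N)"
  proof -
    have "- (q / 2)\<^sup>2 / 2 = - ln (4 * real N / \<alpha>)" unfolding power_divide q2 by simp
    then have "exp (- (q / 2)\<^sup>2 / 2) = inverse (4 * real N / \<alpha>)"
      using \<open>4 * real N / \<alpha> > 1\<close> by (simp only: exp_minus) simp
    then show ?thesis by simp
  qed
  \<comment> \<open>For \<open>c\<close> in the second factor, \<open>Re (c * z)\<close> runs through the signed real and imaginary parts of \<open>z\<close>.\<close>
  define I where "I = unity_roots N \<times> {1, - 1, \<i>, - \<i>}"
  have fin: "finite I" unfolding I_def using unity_roots_props(1)[OF assms(1)] by simp
  define a where "a p t = Re (snd p * fst p ^ t) / sqrt (real N)" for p :: "complex \<times> complex" and t :: nat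
  define E where "E p = {\<xi> \<in> space ?M. (\<Sum>t<N. a p t * \<xi> t) \<ge> q / 2}" for p
  have E: "E p \<in> events" for p unfolding E_def std_gauss_def by measurable
  have PE: "prob (E p) \<le> \<alpha> / (4 * real N)" if "p \<in> I" for p
  proof -
    obtain \<mu> c where p: "p = (\<mu>, c)" by (cases p)
    have "cmod (c * \<mu> ^ t) = 1" for t
      using that unity_roots_props(3)[OF assms(1), of \<mu>] by (auto simp: I_def p norm_mult norm_power)
    then have "\<bar>Re (c * \<mu> ^ t)\<bar> \<le> 1" for t using abs_Re_le_cmod by metis
    then have "(a p t)\<^sup>2 \<le> 1 / real N" for t
      unfolding a_def p by (simp add: power_divide abs_square_le_1 divide_right_mono)
    then have "(\<Sum>t<N. (a p t)\<^sup>2) \<le> (\<Sum>t<N. 1 / real N)" by (intro sum_mono)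
    also have "\<dots> \<le> 1" by simp
    finally have "emeasure ?M (E p) \<le> ennreal (exp (- (q / 2)\<^sup>2 / 2))"
      unfolding E_def using q0 by (intro gauss_linear_tail) auto
    then show ?thesis unfolding ex emeasure_eq_measure using assms by (simp add: ennreal_le_iff)
  qed
  have "{\<xi> \<in> space ?M. ?X \<xi> > q} \<subseteq> (\<Union>p\<in>I. E p)"
  proof
    fix \<xi> assume "\<xi> \<in> {\<xi> \<in> space ?M. ?X \<xi> > q}"
    then have xi: "\<xi> \<in> space ?M" and gt: "?X \<xi> > q" by auto
    obtain \<mu> where mu: "\<mu> \<in> unity_roots N" "cmod (DFT N (\<lambda>t. complex_of_real (\<xi> t)) \<mu>) > q"
      using DFT_norm_le[OF assms(1), of "\<lambda>t. complex_of_real (\<xi> t)" q] gt by force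
    let ?z = "DFT N (\<lambda>t. complex_of_real (\<xi> t)) \<mu>"
    have re: "Re (c * ?z) = (\<Sum>t<N. a (\<mu>, c) t * \<xi> t)" for c
    proof -
      have "c * ?z = (\<Sum>t<N. complex_of_real (\<xi> t / sqrt (real N)) * (c * \<mu> ^ t))"
        by (simp add: DFT_def sum_distrib_left mult_ac)
      also have "Re \<dots> = (\<Sum>t<N. a (\<mu>, c) t * \<xi> t)"
        unfolding a_def by (simp add: field_simps)
      finally show ?thesis .
    qed
    have "q < \<bar>Re ?z\<bar> + \<bar>Im ?z\<bar>" using mu(2) cmod_le[of ?z] by linarith
    then have "\<exists>c\<in>{1, - 1, \<i>, - \<i>}. Re (c * ?z) \<ge> q / 2" by auto
    then show "\<xi> \<in> (\<Union>p\<in>I. E p)" using xi mu(1) unfolding re E_def I_def by auto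
  qed
  then have "prob {\<xi> \<in> space ?M. ?X \<xi> > q} \<le> prob (\<Union>p\<in>I. E p)"
    using fin E by (intro finite_measure_mono) auto
  also have "\<dots> \<le> (\<Sum>p\<in>I. prob (E p))"
    using fin E by (intro finite_measure_subadditive_finite) auto
  also have "\<dots> \<le> (\<Sum>p\<in>I. \<alpha> / (4 * real N))" by (intro sum_mono PE)
  also have "\<dots> \<le> \<alpha>"
  proof -
    have "card I \<le> N * 4"
      unfolding I_def card_cartesian_product unity_roots_props(4)[OF assms(1)]
      by (intro mult_le_mono2) (simp add: card_insert_if)
    then have "real (card I) * (\<alpha> / (4 * real N)) \<le> (real N * 4) * (\<alpha> / (4 * real N))"
      using assms by (intro mult_right_mono) auto
    then show ?thesis using assms(1) by simp
  qed
  finally have "prob {\<xi> \<in> space ?M. ?X \<xi> > q} \<le> \<alpha>" .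
  moreover have "{\<xi> \<in> space ?M. ?X \<xi> \<le> q} \<in> events" using X by measurable
  from prob_compl[OF this] have "prob (space ?M - {\<xi> \<in> space ?M. ?X \<xi> \<le> q}) = 1 - prob {\<xi> \<in> space ?M. ?X \<xi> \<le> q}" .
  moreover have "space ?M - {\<xi> \<in> space ?M. ?X \<xi> \<le> q} = {\<xi> \<in> space ?M. ?X \<xi> > q}" by auto
  ultimately have "prob {\<xi> \<in> space ?M. ?X \<xi> \<le> q} \<ge> 1 - \<alpha>" by simp
  moreover have "bdd_below {q. prob {\<xi> \<in> space ?M. ?X \<xi> \<le> q} \<ge> 1 - \<alpha>}"
  proof (rule bdd_belowI)
    fix x assume "x \<in> {q. prob {\<xi> \<in> space ?M. ?X \<xi> \<le> q} \<ge> 1 - \<alpha>}"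
    then have "prob {\<xi> \<in> space ?M. ?X \<xi> \<le> x} \<noteq> 0" using assms(3) by auto
    then have "{\<xi> \<in> space ?M. ?X \<xi> \<le> x} \<noteq> {}" by (metis measure_empty)
    then show "0 \<le> x" using DFT_norm_nonneg[OF assms(1)] order_trans by blast
  qed
  ultimately have "qN N \<alpha> \<le> q" unfolding qN_def by (intro cInf_lower) auto
  also have "q \<le> sqrt (25 * ln (real N / \<alpha>))"
  proof -
    have "4 \<le> (real N / \<alpha>)\<^sup>2" using power_mono[OF Na, of 2] by simp
    then have "4 * (real N / \<alpha>) \<le> (real N / \<alpha>)\<^sup>2 * (real N / \<alpha>)" using Na by (intro mult_right_mono) auto
    then have "ln (4 * (real N / \<alpha>)) \<le> ln ((real N / \<alpha>) ^ 3)"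
      using Na by (intro ln_mono) (auto simp: power3_eq_cube power2_eq_square)
    also have "\<dots> = 3 * ln (real N / \<alpha>)" using Na by (subst ln_realpow) auto
    finally have "8 * ln (4 * real N / \<alpha>) \<le> 24 * ln (real N / \<alpha>)" by simp
    also have "\<dots> \<le> 25 * ln (real N / \<alpha>)" using Na ln_ge_zero[of "real N / \<alpha>"] by simp
    finally show ?thesis unfolding q_def by (rule real_sqrt_le_mono)
  qed
  also have "\<dots> = 5 * sqrt (ln (real N / \<alpha>))"
    unfolding real_sqrt_mult using real_sqrt_abs[of 5] by simp
  finally show ?thesis .
qed

section \<open>Measurability of the basic test\<close>

lemma Opt_le:
  assumes "N \<ge> 1" "z \<in> Z"
  shows "Opt N Z y \<le> DFT_norm N (\<lambda>t. complex_of_real (y t - z (int t)))"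
  unfolding Opt_def using assms DFT_norm_nonneg by (intro cINF_lower bdd_belowI2[of _ 0]) auto

lemma Opt_cong: "(\<And>t. t < N \<Longrightarrow> y t = y' t) \<Longrightarrow> Opt N Z y = Opt N Z y'"
  unfolding Opt_def by (intro INF_cong refl DFT_norm_cong) auto

text \<open>An infimum of uniformly Lipschitz functions is Lipschitz. This makes the test measurable although the infimum
  ranges over an uncountable set.\<close>

lemma Opt_lipschitz:
  assumes "N \<ge> 1" "Z \<noteq> {}"
  shows "Opt N Z y \<le> Opt N Z y' + sqrt (real N) * (\<Sum>t<N. \<bar>y t - y' t\<bar>)"
proof -
  let ?b = "sqrt (real N) * (\<Sum>t<N. \<bar>y t - y' t\<bar>)"
  have "Opt N Z y - ?b \<le> Opt N Z y'"
    unfolding Opt_def[of N Z y']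
  proof (rule cINF_greatest[OF assms(2)])
    fix z assume z: "z \<in> Z"
    have "Opt N Z y \<le> DFT_norm N (\<lambda>t. complex_of_real (y t - z (int t)))"
      using Opt_le[OF assms(1) z] .
    also have "\<dots> = DFT_norm N (\<lambda>t. complex_of_real (y' t - z (int t)) + complex_of_real (y t - y' t))"
      by simp
    also have "\<dots> \<le> DFT_norm N (\<lambda>t. complex_of_real (y' t - z (int t))) + DFT_norm N (\<lambda>t. complex_of_real (y t - y' t))"
      by (rule DFT_norm_triangle[OF assms(1)])
    also have "DFT_norm N (\<lambda>t. complex_of_real (y t - y' t)) \<le> ?b"
    proof (rule DFT_norm_le_sup[OF assms(1)])
      fix t assume "t < N"
      then show "cmod (complex_of_real (y t - y' t)) \<le> (\<Sum>t<N. \<bar>y t - y' t\<bar>)"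
        unfolding norm_of_real by (intro member_le_sum) auto
    qed
    finally show "Opt N Z y - ?b \<le> DFT_norm N (\<lambda>t. complex_of_real (y' t - z (int t)))" by simp
  qed
  then show ?thesis by simp
qed

text \<open>The infimum is continuous in the product topology on all sequences, whose Borel sets form the countable product
  \<open>\<sigma>\<close>-algebra; extending a vector by zeros transfers this to \<open>vec_space N\<close>.\<close>

lemma Opt_measurable:
  assumes "N \<ge> 1" "Z \<noteq> {}"
  shows "Opt N Z \<in> borel_measurable (vec_space N)"
proof -
  have "continuous_on UNIV (Opt N Z)"
    unfolding continuous_on_def
  proof
    fix y0 :: "nat \<Rightarrow> real"
    let ?g = "\<lambda>y. sqrt (real N) * (\<Sum>t<N. \<bar>y t - y0 t\<bar>)"
    have coord: "((\<lambda>y. y t) \<longlongrightarrow> y0 t) (at y0)" for t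
      using continuous_on_product_coordinates[of t] unfolding continuous_on_def by auto
    have "(?g \<longlongrightarrow> sqrt (real N) * (\<Sum>t<N. \<bar>y0 t - y0 t\<bar>)) (at y0)"
      by (intro tendsto_intros coord)
    then have g: "(?g \<longlongrightarrow> 0) (at y0)" by simp
    have "((\<lambda>y. Opt N Z y - Opt N Z y0) \<longlongrightarrow> 0) (at y0)"
    proof (rule Lim_null_comparison[OF _ g])
      have "norm (Opt N Z y - Opt N Z y0) \<le> ?g y" for y
        using Opt_lipschitz[OF assms, of y y0] Opt_lipschitz[OF assms, of y0 y]
        by (simp add: abs_minus_commute abs_le_iff)
      then show "\<forall>\<^sub>F y in at y0. norm (Opt N Z y - Opt N Z y0) \<le> ?g y" by simp
    qed
    then show "(Opt N Z \<longlongrightarrow> Opt N Z y0) (at y0 within UNIV)" by (simp add: LIM_zero_iff)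
  qed
  then have "Opt N Z \<in> borel_measurable (Pi\<^sub>M UNIV (\<lambda>_. borel))"
    using borel_measurable_continuous_onI measurable_cong_sets[OF sets_PiM_equal_borel refl] by blast
  moreover have "(\<lambda>y i. if i < N then y i else 0) \<in> measurable (vec_space N) (Pi\<^sub>M UNIV (\<lambda>_. borel))"
  proof (rule measurable_PiM_single')
    fix i :: nat
    show "(\<lambda>y. if i < N then y i else (0::real)) \<in> borel_measurable (vec_space N)"
      unfolding vec_space_def by (cases "i < N") (auto intro: measurable_component_singleton)
  qed auto
  ultimately have "(\<lambda>y. Opt N Z (\<lambda>i. if i < N then y i else 0)) \<in> borel_measurable (vec_space N)"
    by (rule measurable_compose[rotated])
  also have "(\<lambda>y. Opt N Z (\<lambda>i. if i < N then y i else 0)) = Opt N Z"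
    by (intro ext Opt_cong) auto
  finally show ?thesis .
qed

lemma basic_test_in_tests:
  assumes "N \<ge> 1" "Z \<noteq> {}"
  shows "basic_test N Z \<alpha> \<in> tests N"
  unfolding tests_def basic_test_def using Opt_measurable[OF assms] by measurable

lemma obs_law_emeasure:
  assumes "\<phi> \<in> tests N" "\<And>\<xi>. \<xi> \<in> space (std_gauss N) \<Longrightarrow> \<phi> (\<lambda>t\<in>{..<N}. x (int t) + \<xi> t) = c \<Longrightarrow> \<xi> \<in> B"
    "B \<in> sets (std_gauss N)"
  shows "emeasure (obs_law N x) {y \<in> space (obs_law N x). \<phi> y = c} \<le> emeasure (std_gauss N) B"
proof -
  let ?T = "\<lambda>\<xi>. \<lambda>t\<in>{..<N}. x (int t) + \<xi> t"
  have "?T \<in> measurable (vec_space N) (vec_space N)"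
    unfolding vec_space_def by (intro measurable_restrict) measurable
  then have T: "?T \<in> measurable (std_gauss N) (vec_space N)"
    by (simp cong: measurable_cong_sets add: sets_std_gauss)
  have "{y \<in> space (vec_space N). \<phi> y = c} = \<phi> -` ({c} \<inter> {0, 1}) \<inter> space (vec_space N)"
    using measurable_space[OF assms(1)[unfolded tests_def]] by auto
  also have "\<dots> \<in> sets (vec_space N)"
    by (rule measurable_sets[OF assms(1)[unfolded tests_def]]) auto
  finally have "{y \<in> space (vec_space N). \<phi> y = c} \<in> sets (vec_space N)" .
  then have "emeasure (obs_law N x) {y \<in> space (obs_law N x). \<phi> y = c}
     = emeasure (std_gauss N) (?T -` {y \<in> space (vec_space N). \<phi> y = c} \<inter> space (std_gauss N))"
    unfolding obs_law_def space_distr by (intro emeasure_distr T)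
  also have "\<dots> \<le> emeasure (std_gauss N) B"
    using assms(2,3) by (intro emeasure_mono) auto
  finally show ?thesis .
qed

section \<open>Risk of the basic test\<close>

lemma apply_shift_eq_filt: "apply_shift p x t = filt p (\<lambda>s. complex_of_real (x s)) t"
proof -
  have "(shift ^^ i) x s = x (s - int i)" for i s
    by (induction i arbitrary: s) (auto simp: shift_def algebra_simps)
  then show ?thesis by (simp add: apply_shift_def filt_def)
qed

lemma char_poly_eq_root_poly: "char_poly w = root_poly (image_mset cis w)"
  by (simp add: char_poly_def root_poly_def image_mset.compositionality comp_def)

lemma le_block_norm: "t < N \<Longrightarrow> norm (f (int t)) \<le> block_norm N f"
  unfolding block_norm_def by (intro Max_ge) auto

lemma block_norm_le_iff: "N \<ge> 1 \<Longrightarrow> block_norm N f \<le> B \<longleftrightarrow> (\<forall>t<N. norm (f (int t)) \<le> B)"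
  unfolding block_norm_def by (subst Max_le_iff) (auto simp: lessThan_empty_iff)

lemma sig_approx_iff:
  assumes "N \<ge> 1"
  shows "x \<in> sig_approx N \<epsilon> w \<longleftrightarrow>
    (\<forall>t<N. cmod (filt (root_poly (image_mset cis w)) (\<lambda>s. complex_of_real (x s)) (int t)) \<le> \<epsilon>)"
  unfolding sig_approx_def mem_Collect_eq block_norm_le_iff[OF assms] apply_shift_eq_filt char_poly_eq_root_poly ..

lemma sig_exact_all_subset: "N \<ge> 1 \<Longrightarrow> sig_exact_all d \<subseteq> sig_approx_all N 0 d"
  unfolding sig_exact_all_def sig_approx_all_def sig_exact_def sig_approx_def by (auto simp: block_norm_le_iff)

lemma zero_in_sig_approx: "N \<ge> 1 \<Longrightarrow> \<epsilon> \<ge> 0 \<Longrightarrow> (\<lambda>_. 0) \<in> sig_approx N \<epsilon> w"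
  by (simp add: sig_approx_iff filt_def)

lemma size_freqs: "w \<in> freqs d \<Longrightarrow> size w = d"
  by (simp add: freqs_def)

text \<open>The deterministic core of the power analysis: if noise and optimal value are both at most \<open>q\<close>, then \<open>x\<close> has
  Fourier distance at most \<open>3 * q\<close> to some \<open>z\<close> in the null hypothesis, and \<open>x - z = (u - z) + s\<close> is uniformly small.
  The constant is \<open>576 * (3 + 2) + 2\<close>.\<close>

lemma alternative_separation:
  assumes N: "N \<ge> 1" and ds: "ds \<ge> 1" and w: "w \<in> freqs dn" and eps: "\<epsilon>n > 0" "\<epsilon>s \<ge> 0"
    and small: "real N powr (real dn + 1/2) * \<epsilon>n + real N powr (real ds + 1/2) * \<epsilon>s \<le> q"
    and x: "x \<in> alternative N (sig_approx N \<epsilon>n w) (sig_approx_all N \<epsilon>s ds) \<rho>"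
    and noise: "DFT_norm N (\<lambda>t. complex_of_real (\<xi> t)) \<le> q"
    and opt: "Opt N (sig_approx N \<epsilon>n w) (\<lambda>t\<in>{..<N}. x (int t) + \<xi> t) \<le> q"
  shows "\<rho> \<le> 2882 * real (dn + ds) ^ 3 * q / sqrt (real N)"
proof -
  let ?Z = "sig_approx N \<epsilon>n w" and ?y = "\<lambda>t\<in>{..<N}. x (int t) + \<xi> t"
  define d where "d = dn + ds"
  have d: "d \<ge> 1" using ds by (simp add: d_def)
  have Npos: "real N > 0" using N by simp
  have "0 < real N powr (real dn + 1/2) * \<epsilon>n" using eps Npos by simp
  moreover have "0 \<le> real N powr (real ds + 1/2) * \<epsilon>s" using eps by simp
  ultimately have q: "q > 0" using small by linarith
  have Z: "?Z \<noteq> {}" using zero_in_sig_approx[OF N, of \<epsilon>n w] eps by auto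
  \<comment> \<open>The infimum need not be attained a priori; a near-minimiser within the slack \<open>q\<close> suffices.\<close>
  have "Opt N ?Z ?y < 2 * q" using opt q by simp
  then obtain z where z: "z \<in> ?Z" "DFT_norm N (\<lambda>t. complex_of_real (?y t - z (int t))) < 2 * q"
    unfolding Opt_def using Z DFT_norm_nonneg[OF N] by (subst (asm) cINF_less_iff) (auto intro: bdd_belowI2[of _ 0])
  obtain u s w' where u: "u \<in> ?Z" and w': "w' \<in> freqs ds" and s: "s \<in> sig_approx N \<epsilon>s w'" and xus: "x = (\<lambda>t. u t + s t)"
    using x unfolding alternative_def sig_approx_all_def by blast
  define a where "a t = complex_of_real (u t - z t)" for t
  define b where "b t = complex_of_real (s t)" for t
  have ab: "a t + b t = complex_of_real (x t - z t)" for t by (simp add: a_def b_def xus)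
  have "DFT_norm N (\<lambda>t. a (int t) + b (int t))
     = DFT_norm N (\<lambda>t. complex_of_real (?y t - z (int t)) + - complex_of_real (\<xi> t))"
    by (rule DFT_norm_cong) (simp add: ab)
  also have "\<dots> \<le> DFT_norm N (\<lambda>t. complex_of_real (?y t - z (int t))) + DFT_norm N (\<lambda>t. complex_of_real (\<xi> t))"
    using DFT_norm_triangle[OF N, of _ "\<lambda>t. - complex_of_real (\<xi> t)"] unfolding DFT_norm_uminus .
  finally have F: "DFT_norm N (\<lambda>t. a (int t) + b (int t)) \<le> 3 * q" using z(2) noise by simp

  define \<eta> where "\<eta> = real N ^ dn * (2 * \<epsilon>n) + real N ^ ds * \<epsilon>s"
  have pw: "real N powr (real k + 1/2) = real N ^ k * sqrt (real N)" for k
    unfolding powr_add using Npos by (simp add: powr_realpow powr_half_sqrt)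
  have eta: "sqrt (real N) * \<eta> \<le> 2 * q"
  proof -
    have "sqrt (real N) * \<eta> = 2 * (real N ^ dn * sqrt (real N) * \<epsilon>n) + real N ^ ds * sqrt (real N) * \<epsilon>s"
      by (simp add: \<eta>_def algebra_simps)
    moreover have "0 \<le> real N ^ ds * sqrt (real N) * \<epsilon>s" using eps by simp
    ultimately show ?thesis using small unfolding pw by linarith
  qed
  have bound: "cmod (complex_of_real (x (int t) - z (int t))) \<le> 2882 * real d ^ 3 * q / sqrt (real N)" if t: "t < N" for t
  proof -
    have "cmod (a (int t) + b (int t)) \<le> 576 * real d ^ 3 / sqrt (real N)
        * (DFT_norm N (\<lambda>s. a (int s) + b (int s)) + sqrt (real N) * \<eta>) + \<eta>"
      unfolding \<eta>_def size_freqs[OF w, symmetric] size_freqs[OF w', symmetric]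
        size_image_mset[of cis, symmetric]
    proof (rule approximate_sum_bound)
      show "cmod (filt (root_poly (image_mset cis w)) a (int t)) \<le> 2 * \<epsilon>n" if "t < N" for t
      proof -
        have "filt (root_poly (image_mset cis w)) a (int t)
           = filt (root_poly (image_mset cis w)) (\<lambda>s. complex_of_real (u s)) (int t)
             - filt (root_poly (image_mset cis w)) (\<lambda>s. complex_of_real (z s)) (int t)"
          unfolding a_def of_real_diff filt_diff_right ..
        also have "cmod \<dots> \<le> \<epsilon>n + \<epsilon>n"
          using u z(1) that unfolding sig_approx_iff[OF N]
          by (intro order_trans[OF norm_triangle_ineq4] add_mono) auto
        finally show ?thesis by simp
      qed
      show "cmod (filt (root_poly (image_mset cis w')) b (int t)) \<le> \<epsilon>s" if "t < N" for t
        using s that unfolding sig_approx_iff[OF N] b_def by blast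
      show "d = size (image_mset cis w) + size (image_mset cis w')"
        using size_freqs[OF w] size_freqs[OF w'] by (simp add: d_def)
    qed (use d t eps in auto)
    also have "\<dots> \<le> 576 * real d ^ 3 / sqrt (real N) * (3 * q + 2 * q) + 2 * q / sqrt (real N)"
      using F eta Npos by (intro add_mono mult_left_mono) (auto simp: pos_le_divide_eq mult.commute)
    also have "\<dots> = (2880 * real d ^ 3 * q + 2 * q) / sqrt (real N)"
      by (simp add: add_divide_distrib)
    also have "\<dots> \<le> (2880 * real d ^ 3 * q + 2 * (real d ^ 3 * q)) / sqrt (real N)"
    proof -
      have "1 * q \<le> real d ^ 3 * q" using q d by (intro mult_right_mono one_le_power) auto
      then have "q \<le> real d ^ 3 * q" by simp
      then show ?thesis by (intro divide_right_mono add_left_mono mult_left_mono) simp_all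
    qed
    finally show ?thesis unfolding ab by (simp add: algebra_simps)
  qed
  have "\<rho> \<le> (INF z\<in>?Z. block_norm N (\<lambda>t. x t - z t))"
    using x unfolding alternative_def by blast
  also have "\<dots> \<le> block_norm N (\<lambda>t. x t - z t)"
  proof (rule cINF_lower[OF bdd_belowI2[of _ 0] z(1)])
    show "0 \<le> block_norm N (\<lambda>t. x t - z' t)" for z'
      using N by (intro order_trans[OF norm_ge_zero le_block_norm[of 0 N "\<lambda>t. x t - z' t"]]) simp
  qed
  also have "\<dots> \<le> 2882 * real d ^ 3 * q / sqrt (real N)"
    unfolding block_norm_le_iff[OF N] using bound by (simp only: norm_of_real real_norm_def) blast
  finally show ?thesis unfolding d_def .
qed

text \<open>Both kinds of error are contained in the event that the Fourier norm of the noise exceeds the quantile.\<close>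

lemma basic_test_risk:
  assumes N: "N \<ge> 1" and ds: "ds \<ge> 1" and al: "0 < \<alpha>" "\<alpha> < 1/2" and w: "w \<in> freqs dn" and eps: "\<epsilon>n > 0" "\<epsilon>s \<ge> 0"
    and small: "real N powr (real dn + 1/2) * \<epsilon>n + real N powr (real ds + 1/2) * \<epsilon>s \<le> qN N \<alpha>"
    and rho: "\<rho> > 2882 * real (dn + ds) ^ 3 * qN N \<alpha> / sqrt (real N)"
    and S: "S \<subseteq> sig_approx_all N \<epsilon>s ds"
  shows "risk N (sig_approx N \<epsilon>n w) (alternative N (sig_approx N \<epsilon>n w) S \<rho>) (basic_test N (sig_approx N \<epsilon>n w) \<alpha>) \<le> ennreal \<alpha>"
proof -
  let ?Z = "sig_approx N \<epsilon>n w"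
  let ?\<phi> = "basic_test N ?Z \<alpha>"
  define B where "B = {\<xi> \<in> space (std_gauss N). DFT_norm N (\<lambda>t. complex_of_real (\<xi> t)) > qN N \<alpha>}"
  have B: "B \<in> sets (std_gauss N)"
    unfolding B_def sets_std_gauss space_std_gauss using DFT_norm_measurable[OF N] by measurable
  have PB: "emeasure (std_gauss N) B \<le> ennreal \<alpha>"
    unfolding B_def using al by (intro gauss_DFT_exceeds_quantile N) auto
  have "?Z \<noteq> {}" using zero_in_sig_approx[OF N, of \<epsilon>n w] eps by auto
  then have test: "?\<phi> \<in> tests N" by (rule basic_test_in_tests[OF N])
  have "emeasure (obs_law N x) {y \<in> space (obs_law N x). ?\<phi> y = 1} \<le> ennreal \<alpha>" if "x \<in> ?Z" for x
  proof (rule order_trans[OF obs_law_emeasure[OF test _ B] PB])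
    fix \<xi> assume xi: "\<xi> \<in> space (std_gauss N)" and "?\<phi> (\<lambda>t\<in>{..<N}. x (int t) + \<xi> t) = 1"
    then have "Opt N ?Z (\<lambda>t\<in>{..<N}. x (int t) + \<xi> t) > qN N \<alpha>"
      by (auto simp: basic_test_def split: if_splits)
    moreover have "Opt N ?Z (\<lambda>t\<in>{..<N}. x (int t) + \<xi> t) \<le> DFT_norm N (\<lambda>t. complex_of_real ((\<lambda>t\<in>{..<N}. x (int t) + \<xi> t) t - x (int t)))"
      by (rule Opt_le[OF N that])
    moreover have "\<dots> = DFT_norm N (\<lambda>t. complex_of_real (\<xi> t))"
      by (rule DFT_norm_cong) simp
    ultimately show "\<xi> \<in> B" using xi unfolding B_def by simp
  qed
  moreover have "emeasure (obs_law N x) {y \<in> space (obs_law N x). ?\<phi> y = 0} \<le> ennreal \<alpha>"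
    if x: "x \<in> alternative N ?Z S \<rho>" for x
  proof (rule order_trans[OF obs_law_emeasure[OF test _ B] PB])
    fix \<xi> assume xi: "\<xi> \<in> space (std_gauss N)" and "?\<phi> (\<lambda>t\<in>{..<N}. x (int t) + \<xi> t) = 0"
    then have opt: "Opt N ?Z (\<lambda>t\<in>{..<N}. x (int t) + \<xi> t) \<le> qN N \<alpha>"
      by (auto simp: basic_test_def split: if_splits)
    have "x \<in> alternative N ?Z (sig_approx_all N \<epsilon>s ds) \<rho>" using x S unfolding alternative_def by blast
    then have "\<not> DFT_norm N (\<lambda>t. complex_of_real (\<xi> t)) \<le> qN N \<alpha>"
      using alternative_separation[OF N ds w eps small _ _ opt] rho by fastforce
    then show "\<xi> \<in> B" using xi unfolding B_def by simp
  qed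
  ultimately show ?thesis unfolding risk_def by (intro max.boundedI SUP_least)
qed

theorem theorem3p2:
  shows "\<exists>C1 C2 C3 :: real. C1 > 0 \<and> C2 > 0 \<and> C3 > 0 \<and>
    (\<forall>(N::nat) (dn::nat) (ds::nat) (\<alpha>::real) (w::real multiset) (\<epsilon>n::real) (\<epsilon>s::real) (\<rho>::real).
       N \<ge> 1 \<longrightarrow> ds \<ge> 1 \<longrightarrow> 0 < \<alpha> \<longrightarrow> \<alpha> < 1/2 \<longrightarrow> w \<in> freqs dn \<longrightarrow> \<epsilon>n > 0 \<longrightarrow> \<rho> > 0 \<longrightarrow>
       (\<rho> \<ge> C1 * real (dn + ds) ^ 3 * ln (2 * real (dn + ds)) * qN N \<alpha> * real N powr (- 1/2) \<or>
        \<rho> \<ge> C2 * real (dn + ds) ^ 3 * ln (2 * real (dn + ds)) * sqrt (ln (real N / \<alpha>) / real N)) \<longrightarrow>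
       real N powr (real dn + 1/2) * \<epsilon>n + real N powr (real ds + 1/2) * \<epsilon>s \<le> C3 * qN N \<alpha> \<longrightarrow>
       (let Z = sig_approx N \<epsilon>n w; \<phi> = basic_test N Z \<alpha> in
          (\<epsilon>s = 0 \<longrightarrow> \<phi> \<in> tests N \<and> risk N Z (H1_N1 N w \<epsilon>n ds \<rho>) \<phi> \<le> ennreal \<alpha>) \<and>
          (\<epsilon>s > 0 \<longrightarrow> \<phi> \<in> tests N \<and> risk N Z (H1_N2 N w \<epsilon>n ds \<epsilon>s \<rho>) \<phi> \<le> ennreal \<alpha>)))"
proof (rule exI[of _ 5000], rule exI[of _ 25000], rule exI[of _ 1], intro conjI allI impI)
  fix N dn ds :: nat and \<alpha> :: real and w :: "real multiset" and \<epsilon>n \<epsilon>s \<rho> :: real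
  assume N: "N \<ge> 1" and ds: "ds \<ge> 1" and al: "0 < \<alpha>" "\<alpha> < 1/2" and w: "w \<in> freqs dn" and en: "\<epsilon>n > 0"
    and rho: "\<rho> \<ge> 5000 * real (dn + ds) ^ 3 * ln (2 * real (dn + ds)) * qN N \<alpha> * real N powr (- 1/2) \<or>
        \<rho> \<ge> 25000 * real (dn + ds) ^ 3 * ln (2 * real (dn + ds)) * sqrt (ln (real N / \<alpha>) / real N)"
    and small: "real N powr (real dn + 1/2) * \<epsilon>n + real N powr (real ds + 1/2) * \<epsilon>s \<le> 1 * qN N \<alpha>"
  let ?Z = "sig_approx N \<epsilon>n w"
  let ?d = "real (dn + ds)"
  have Npos: "real N > 0" using N by simp
  have d1: "?d \<ge> 1" using ds by simp
  have "ln 2 \<le> ln (2 * ?d)" using d1 by (intro ln_mono) auto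
  then have ln: "ln (2 * ?d) \<ge> 2 / 3" using ln2_ge_two_thirds by linarith
  have risk: "basic_test N ?Z \<alpha> \<in> tests N
      \<and> risk N ?Z (alternative N ?Z S \<rho>) (basic_test N ?Z \<alpha>) \<le> ennreal \<alpha>"
    if es: "\<epsilon>s \<ge> 0" and S: "S \<subseteq> sig_approx_all N \<epsilon>s ds" for S
  proof
    have "0 < real N powr (real dn + 1/2) * \<epsilon>n" using en Npos by simp
    moreover have "0 \<le> real N powr (real ds + 1/2) * \<epsilon>s" using es by simp
    ultimately have q: "qN N \<alpha> > 0" using small by linarith
    have pw: "real N powr (- 1/2) = 1 / sqrt (real N)"
      using powr_minus_divide[of "real N" "1/2"] Npos by (simp add: powr_half_sqrt)
    let ?c = "?d ^ 3 * ln (2 * ?d)"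
    have c0: "?c \<ge> 0" using ln by simp
    \<comment> \<open>The factor \<open>5 = 25000 / 5000\<close> makes the second condition imply the first: \<open>qN N \<alpha> \<le> 5 * sqrt (ln (N / \<alpha>))\<close>.\<close>
    have "\<rho> \<ge> 5000 * ?c * (qN N \<alpha> / sqrt (real N))"
    proof (rule disjE[OF rho])
      assume "\<rho> \<ge> 25000 * ?d ^ 3 * ln (2 * ?d) * sqrt (ln (real N / \<alpha>) / real N)"
      moreover have "qN N \<alpha> / sqrt (real N) \<le> 5 * sqrt (ln (real N / \<alpha>)) / sqrt (real N)"
        using qN_upper_bound[OF N al] by (intro divide_right_mono) auto
      then have "5000 * ?c * (qN N \<alpha> / sqrt (real N)) \<le> 5000 * ?c * (5 * sqrt (ln (real N / \<alpha>)) / sqrt (real N))"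
        using c0 by (intro mult_left_mono) auto
      ultimately show ?thesis by (simp add: real_sqrt_divide mult_ac)
    next
      assume "\<rho> \<ge> 5000 * ?d ^ 3 * ln (2 * ?d) * qN N \<alpha> * real N powr (- 1/2)"
      then show ?thesis unfolding pw by (simp add: mult_ac)
    qed
    moreover have "2882 * ?d ^ 3 * qN N \<alpha> / sqrt (real N) < 5000 * ?c * (qN N \<alpha> / sqrt (real N))"
    proof -
      \<comment> \<open>\<open>5000 * ln 2 \<ge> 5000 * 2 / 3 > 2882\<close>\<close>
      have "2882 * (?d ^ 3 * (qN N \<alpha> / sqrt (real N))) < (5000 * ln (2 * ?d)) * (?d ^ 3 * (qN N \<alpha> / sqrt (real N)))"
        using ln q Npos d1 by (intro mult_strict_right_mono) auto
      then show ?thesis by (simp add: mult_ac)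
    qed
    ultimately have "\<rho> > 2882 * ?d ^ 3 * qN N \<alpha> / sqrt (real N)" by linarith
    then show "risk N ?Z (alternative N ?Z S \<rho>) (basic_test N ?Z \<alpha>) \<le> ennreal \<alpha>"
      using small S by (intro basic_test_risk[OF N ds al w en es]) auto
    have "?Z \<noteq> {}" using zero_in_sig_approx[OF N, of \<epsilon>n w] en by auto
    then show "basic_test N ?Z \<alpha> \<in> tests N" by (rule basic_test_in_tests[OF N])
  qed
  show "let Z = ?Z; \<phi> = basic_test N Z \<alpha> in
          (\<epsilon>s = 0 \<longrightarrow> \<phi> \<in> tests N \<and> risk N Z (H1_N1 N w \<epsilon>n ds \<rho>) \<phi> \<le> ennreal \<alpha>) \<and>
          (\<epsilon>s > 0 \<longrightarrow> \<phi> \<in> tests N \<and> risk N Z (H1_N2 N w \<epsilon>n ds \<epsilon>s \<rho>) \<phi> \<le> ennreal \<alpha>)"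
    unfolding Let_def H1_N1_def H1_N2_def
    using risk[of "sig_exact_all ds"] risk[of "sig_approx_all N \<epsilon>s ds"] sig_exact_all_subset[OF N, of ds] by auto
qed simp_all

end
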